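(* Let $M$ be a compact orientable manifold of positive dimension, and let $\Gamma$ be a finitely generated dense subgroup of $\mathrm{Homeo}_{+}(M)$. Then $\mathrm{girth}(\Gamma)=\infty$.
   Context: $\mathrm{Homeo}_{+}(M)$ is the group of orientation preserving homeomorphisms of $M$ with its natural $C_0$ topology (uniform convergence); density refers to this topology. Manifolds may have boundary (for example $M=[0,1]$ is included). For a finitely generated group $\Gamma$ and a finite generating set $S$ of $\Gamma$, $\mathrm{girth}(\Gamma,S)$ denotes the minimal length of relations among the elements of $S$, i.e. the minimal length of a non-trivial reduced word in the elements of $S$ and their inverses (viewed as formal letters) that equals $1$ in $\Gamma$, with value $\infty$ if there is no such word. Then $\mathrm{girth}(\Gamma)=\sup\{\mathrm{girth}(\Gamma,S) : \langle S\rangle=\Gamma,\ |S|<\infty\}$. *)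

theory Defs
  imports "HOL-Homology.Homology" "HOL-Algebra.Bij" "HOL-Algebra.Generated_Groups" "HOL-Analysis.Analysis"
    "HOL-Library.Extended_Nat"
begin

definition half_space :: "nat \<Rightarrow> (nat \<Rightarrow> real) topology"
  where "half_space n = subtopology (Euclidean_space n) {x. 0 \<le> x 0}"

text \<open>
  A topological manifold of dimension \<open>n\<close>, possibly with boundary; neither connectedness nor
  emptiness of the boundary is required.
\<close>

definition topological_manifold :: "nat \<Rightarrow> 'a topology \<Rightarrow> bool"
  where "topological_manifold n M \<longleftrightarrow>
    Hausdorff_space M \<and> second_countable M \<and>
    (\<forall>x\<in>topspace M. \<exists>U V. openin M U \<and> x \<in> U \<and> openin (half_space n) V \<and>
       subtopology M U homeomorphic_space subtopology (half_space n) V)"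

definition manifold_interior :: "nat \<Rightarrow> 'a topology \<Rightarrow> 'a set"
  where "manifold_interior n M =
    {x \<in> topspace M. \<exists>U V. openin M U \<and> x \<in> U \<and> openin (Euclidean_space n) V \<and>
       subtopology M U homeomorphic_space subtopology (Euclidean_space n) V}"

text \<open>
  An orientation is a continuous choice of a generator of the local homology group
  \<open>H\<^sub>n(M, M - {x})\<close>, which is infinite cyclic, at every interior point \<open>x\<close>.  By excision these
  groups do not change when \<open>M\<close> is replaced by its interior.  Continuity means that
  near every interior point the generators come from one class in \<open>H\<^sub>n(M, M - U)\<close> for some
  neighbourhood \<open>U\<close>.  Values of \<open>\<mu>\<close> outside the interior are irrelevant.
\<close>

definition orientation :: "nat \<Rightarrow> 'a topology \<Rightarrow> ('a \<Rightarrow> 'a chain set) \<Rightarrow> bool"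
  where "orientation n M \<mu> \<longleftrightarrow>
    (\<forall>x\<in>manifold_interior n M.
       \<mu> x \<in> carrier (relative_homology_group (int n) M (topspace M - {x})) \<and>
       generate (relative_homology_group (int n) M (topspace M - {x})) {\<mu> x} =
         carrier (relative_homology_group (int n) M (topspace M - {x}))) \<and>
    (\<forall>x\<in>manifold_interior n M. \<exists>U. openin M U \<and> x \<in> U \<and> U \<subseteq> manifold_interior n M \<and>
       (\<exists>c\<in>carrier (relative_homology_group (int n) M (topspace M - U)).
          \<forall>y\<in>U. hom_induced (int n) M (topspace M - U) M (topspace M - {y}) (\<lambda>z. z) c = \<mu> y))"

definition orientation_preserving ::
    "nat \<Rightarrow> 'a topology \<Rightarrow> ('a \<Rightarrow> 'a chain set) \<Rightarrow> ('a \<Rightarrow> 'a) \<Rightarrow> bool"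
  where "orientation_preserving n M \<mu> f \<longleftrightarrow>
    (\<forall>x\<in>manifold_interior n M.
       hom_induced (int n) M (topspace M - {x}) M (topspace M - {f x}) f (\<mu> x) = \<mu> (f x))"

text \<open>
  Self-maps of \<open>M\<close> are represented by extensional functions, as in \<open>BijGroup\<close> and \<open>cfunspace\<close>.
\<close>

definition Homeo_plus ::
    "nat \<Rightarrow> 'a topology \<Rightarrow> ('a \<Rightarrow> 'a chain set) \<Rightarrow> ('a \<Rightarrow> 'a) monoid"
  where "Homeo_plus n M \<mu> = BijGroup (topspace M)
    \<lparr>carrier := {f \<in> extensional (topspace M). homeomorphic_map M M f \<and>
                    orientation_preserving n M \<mu> f}\<rparr>"

text \<open>
  The topology of uniform convergence with respect to a metric \<open>d\<close> that induces the topology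
  of \<open>M\<close>.  For compact \<open>M\<close> it does not depend on \<open>d\<close>.
\<close>

definition C0_topology ::
    "nat \<Rightarrow> 'a topology \<Rightarrow> ('a \<Rightarrow> 'a chain set) \<Rightarrow> 'a metric \<Rightarrow> ('a \<Rightarrow> 'a) topology"
  where "C0_topology n M \<mu> d =
    subtopology (mtopology_of (cfunspace M d)) (carrier (Homeo_plus n M \<mu>))"

definition finite_generating_set :: "('g, 'b) monoid_scheme \<Rightarrow> 'g set \<Rightarrow> bool"
  where "finite_generating_set G S \<longleftrightarrow>
    finite S \<and> S \<subseteq> carrier G \<and> generate G S = carrier G"

text \<open>
  A letter is a pair \<open>(s, e)\<close>, standing for \<open>s\<close> if \<open>e\<close> holds and for the formal inverse of \<open>s\<close>
  otherwise.  The formal inverse of \<open>s\<close> is a different letter from any element of the generating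
  set, even if it has the same value in the group.
\<close>

type_synonym 'g letter = "'g \<times> bool"

definition reduced_word :: "'g letter list \<Rightarrow> bool"
  where "reduced_word w \<longleftrightarrow>
    successively (\<lambda>a b. \<not> (fst a = fst b \<and> snd a \<noteq> snd b)) w"

definition letter_value :: "('g, 'b) monoid_scheme \<Rightarrow> 'g letter \<Rightarrow> 'g"
  where "letter_value G a = (if snd a then fst a else inv\<^bsub>G\<^esub> (fst a))"

definition word_value :: "('g, 'b) monoid_scheme \<Rightarrow> 'g letter list \<Rightarrow> 'g"
  where "word_value G w = foldr (\<lambda>a g. letter_value G a \<otimes>\<^bsub>G\<^esub> g) w \<one>\<^bsub>G\<^esub>"

definition relations :: "('g, 'b) monoid_scheme \<Rightarrow> 'g set \<Rightarrow> 'g letter list set"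
  where "relations G S =
    {w. w \<noteq> [] \<and> fst ` set w \<subseteq> S \<and> reduced_word w \<and> word_value G w = \<one>\<^bsub>G\<^esub>}"

text \<open>The infimum of the empty set in \<open>enat\<close> is \<open>\<infinity>\<close>.\<close>

definition girth_wrt :: "('g, 'b) monoid_scheme \<Rightarrow> 'g set \<Rightarrow> enat"
  where "girth_wrt G S = (INF w\<in>relations G S. enat (length w))"

definition girth :: "('g, 'b) monoid_scheme \<Rightarrow> enat"
  where "girth G = (SUP S\<in>{S. finite_generating_set G S}. girth_wrt G S)"

end

theory Submission
  imports Defs
begin

text \<open>
  Let \<open>c\<^sub>1, \<dots>, c\<^sub>k\<close> generate \<open>\<Gamma>\<close> and let \<open>m\<close> be given.  For any two elements \<open>x\<close> and \<open>z\<close> of \<open>\<Gamma>\<close> and for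
  \<open>K = m + 1\<close>, the elements \<open>x\<close>, \<open>z\<close> and \<open>x\<^sup>K\<^sup>i c\<^sub>i z\<^sup>-\<^sup>K\<^sup>i\<close> generate \<open>\<Gamma>\<close> as well.  It is enough to choose
  \<open>x\<close> and \<open>z\<close> such that no reduced word of length at most \<open>m\<close> in these elements is trivial.

  Expanding such a word and cancelling powers of \<open>x\<close> and of \<open>z\<close> gives a product in which nonzero powers
  of \<open>x\<close> and \<open>z\<close> alternate, with a coefficient \<open>1\<close>, \<open>c\<^sub>i\<close> or the inverse of \<open>c\<^sub>i\<close> between them
  (\<open>block_form_exists\<close>).  Even if the coefficients are trivial or satisfy many relations, nothing more
  can be cancelled: the wrapping with different letters on the two sides ensures that no coefficient is
  ever enclosed by powers of the same letter, and the gaps between the exponents \<open>K * i\<close> ensure that no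
  exponent becomes zero.

  Next, finitely many of these products are made nontrivial at once by elements \<open>x\<close> and \<open>z\<close> of the whole
  group of homeomorphisms.  One follows the orbit of a point through the product, factor by factor, and
  modifies \<open>x\<close> and \<open>z\<close> at the current point, so that the orbit never returns to a place where the
  letter needed next has been prescribed already, and so that it does not end where it began
  (\<open>redirect_block_value\<close>, \<open>simultaneously_nontrivial_values\<close>).  The geometric input is that an interior
  point can be moved off a finite set by an orientation preserving homeomorphism that fixes finitely
  many given points (\<open>Homeo_plus_movable\<close>).  Such a map is a small push in a chart; it preserves the
  orientation because it is isotopic to the identity within a set on which the orientation is given by
  a single homology class (\<open>supported_isotopy_orientation_preserving\<close>).

  Finally, the condition that a product moves some point is open in the topology of uniform convergence
  (\<open>point_lim_block_value\<close>), so by density \<open>x\<close> and \<open>z\<close> can be taken from \<open>\<Gamma>\<close>.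
\<close>

section \<open>Short words in wrapped generators\<close>

text \<open>
  A block \<open>(s, n, g)\<close> stands for the group element \<open>g * t s ^ n\<close>, where \<open>t True\<close> and \<open>t False\<close> are two elements to
  be chosen later and \<open>g\<close> is a fixed coefficient.  A list of blocks is thus a word in the free
  product of the coefficient group with a free group of rank two.  It is listed in the order in which
  its factors act on a point: the head of the list is the rightmost factor of the product.
\<close>

type_synonym 'g block = "bool \<times> int \<times> 'g"

definition block_list :: "'g set \<Rightarrow> 'g block list \<Rightarrow> bool"
  where "block_list A bs \<longleftrightarrow>
    bs \<noteq> [] \<and> successively (\<lambda>b b'. fst b \<noteq> fst b') bs \<and>
    (\<forall>(s, n, g) \<in> set bs. n \<noteq> 0 \<and> g \<in> A)"

lemma small_multiple_eq:
  fixes c K :: int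
  assumes "\<bar>c\<bar> < K" "c - K * int i + K * int j = 0"
  shows "c = 0" "i = j"
proof -
  have "c = K * (int i - int j)" using assms(2) by (simp add: algebra_simps)
  moreover have "K > 0" using assms(1) by linarith
  ultimately have "\<bar>c\<bar> = K * \<bar>int i - int j\<bar>" by (simp add: abs_mult)
  moreover have "K \<le> K * \<bar>int i - int j\<bar>" if "i \<noteq> j"
  proof -
    have "1 \<le> \<bar>int i - int j\<bar>" using that by linarith
    then have "K * 1 \<le> K * \<bar>int i - int j\<bar>" by (rule mult_left_mono) (use assms(1) in linarith)
    then show ?thesis by simp
  qed
  ultimately show "i = j" using assms(1) by fastforce
  then show "c = 0" using assms(2) by simp
qed

context group
begin

fun block_value :: "(bool \<Rightarrow> 'a) \<Rightarrow> 'a block list \<Rightarrow> 'a"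
  where "block_value t [] = \<one>"
  | "block_value t ((s, n, g) # bs) = block_value t bs \<otimes> (g \<otimes> t s [^] n)"

text \<open>
  The labels of the new generators.  Two stable letters \<open>t True\<close> and \<open>t False\<close> are kept as
  generators, and every old generator \<open>c i\<close> is wrapped between powers of the two.  Words are
  written over labels rather than over their values, because different labels may take equal values.
\<close>

fun label_value :: "(bool \<Rightarrow> 'a) \<Rightarrow> int \<Rightarrow> (nat \<Rightarrow> 'a) \<Rightarrow> bool + nat \<Rightarrow> 'a"
  where "label_value t K c (Inl s) = t s"
  | "label_value t K c (Inr i) = t True [^] (K * int i) \<otimes> c i \<otimes> t False [^] (- (K * int i))"

lemma block_value_closed:
  assumes "\<And>s. t s \<in> carrier G" "A \<subseteq> carrier G" "\<forall>(s, n, g) \<in> set bs. n \<noteq> 0 \<and> g \<in> A"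
  shows "block_value t bs \<in> carrier G"
  using assms(3) by (induction bs) (use assms in auto)

lemma label_value_closed:
  assumes "\<And>s. t s \<in> carrier G" "\<And>i. Inr i = a \<Longrightarrow> c i \<in> carrier G"
  shows "label_value t K c a \<in> carrier G"
  using assms by (cases a) auto

lemma word_value_append:
  assumes "fst ` set v \<subseteq> carrier G" "fst ` set w \<subseteq> carrier G"
  shows "word_value G (v @ w) = word_value G v \<otimes> word_value G w"
    and "word_value G w \<in> carrier G"
proof -
  have closed: "word_value G w \<in> carrier G" if "fst ` set w \<subseteq> carrier G" for w
    using that by (induction w) (auto simp: word_value_def letter_value_def)
  then show "word_value G w \<in> carrier G" using assms by blast
  show "word_value G (v @ w) = word_value G v \<otimes> word_value G w"
    using assms
  proof (induction v)
    case Nil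
    then show ?case using closed by (simp add: word_value_def)
  next
    case (Cons a v)
    have "letter_value G a \<in> carrier G"
      using Cons.prems by (auto simp: letter_value_def)
    moreover have "word_value G v \<in> carrier G" using closed Cons.prems by simp
    ultimately show ?case using Cons closed by (simp add: word_value_def m_assoc)
  qed
qed

text \<open>
  The formal inverse of a wrapped generator has the same shape with the two stable letters exchanged.
  This symmetry halves the case analysis below.
\<close>

lemma letter_value_spread:
  assumes "\<And>s. t s \<in> carrier G" "c j \<in> carrier G"
  shows "letter_value G (label_value t K c (Inr j), e) =
    t e [^] (K * int j) \<otimes> ((if e then c j else inv (c j)) \<otimes> t (\<not> e) [^] (- (K * int j)))"
  using assms by (cases e) (auto simp: letter_value_def inv_mult_group m_assoc int_pow_neg)

lemma letter_value_stable:
  assumes "t s \<in> carrier G"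
  shows "letter_value G (label_value t K c (Inl s), e) = t s [^] (if e then 1 else - 1 :: int)"
  using assms by (cases e) (auto simp: letter_value_def int_pow_neg)

text \<open>
  A short reduced word in the new generators has an alternating block form with nonzero exponents,
  whatever relations hold among the coefficients, and the form does not depend on \<open>t\<close>.  The reason is
  that a coefficient always stands between powers of the two different stable letters, and that the
  wrapping exponents are distinct multiples of \<open>K\<close>, whereas the single stable letters in a word shorter
  than \<open>K\<close> add less than \<open>K\<close> in absolute value.

  The list \<open>u\<close> is the word in the order of action, and the induction adds a letter that acts first.  The
  invariant describes the first exponent as \<open>d - K * i\<close>: the word \<open>u\<close> starts with a run of \<open>\<bar>d\<bar>\<close> copies
  of one stable letter, and a wrapped generator next to this run contributes \<open>- K * i\<close>, with \<open>i = 0\<close> if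
  there is no contribution.  Thus \<open>d\<close> determines the letter that acts first, and reducedness of the
  word excludes total cancellation.
\<close>

lemma block_form_exists:
  fixes u :: "(bool + nat) letter list" and K :: int
  assumes "u \<noteq> []" "reduced_word u" "int (length u) < K" "Inr -` fst ` set u \<subseteq> I"
    and I: "0 \<notin> I" "c ` I \<subseteq> carrier G"
  defines "A \<equiv> {\<one>} \<union> c ` I \<union> m_inv G ` c ` I"
  shows "\<exists>s n g bs d i. block_list A ((s, n, g) # bs) \<and>
    (\<forall>t. (\<forall>s. t s \<in> carrier G) \<longrightarrow>
      word_value G (map (\<lambda>(a, e). (label_value t K c a, e)) (rev u)) = block_value t ((s, n, g) # bs)) \<and>
    n = d - K * int i \<and> \<bar>d\<bar> \<le> int (length u) \<and>
    (d > 0 \<longrightarrow> hd u = (Inl s, True)) \<and> (d < 0 \<longrightarrow> hd u = (Inl s, False)) \<and>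
    (d = 0 \<longrightarrow> hd u = (Inr i, \<not> s))"
  using assms(1-4)
proof (induction u)
  case Nil
  then show ?case by simp
next
  case (Cons a u)
  obtain x e where a: "a = (x, e)" by (cases a)
  have A: "A \<subseteq> carrier G" "\<one> \<in> A" using I by (auto simp: A_def)
  have K: "K > 0" using Cons.prems(3) by simp
  define W where "W t v = word_value G (map (\<lambda>(a, e). (label_value t K c a, e)) (rev v))" for t v
  have W_Nil: "W t [] = \<one>" for t by (simp add: W_def word_value_def)
  have W_closed: "W t v \<in> carrier G"
    and W_Cons: "W t ((x', e') # v) = W t v \<otimes> letter_value G (label_value t K c x', e')"
    if t: "\<forall>s. t s \<in> carrier G" and v: "Inr -` fst ` set ((x', e') # v) \<subseteq> I" for t v x' e'
  proof -
    have *: "fst ` set (map (\<lambda>(a, e). (label_value t K c a, e)) (rev v)) \<subseteq> carrier G"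
    proof -
      have "label_value t K c b \<in> carrier G" if "(b, e'') \<in> set v" for b e''
      proof (rule label_value_closed)
        fix i assume "Inr i = b"
        then have "i \<in> I" using that v by force
        then show "c i \<in> carrier G" using I by auto
      qed (use t in auto)
      then show ?thesis by auto
    qed
    have **: "label_value t K c x' \<in> carrier G"
      by (rule label_value_closed) (use t v I in force)+
    show "W t v \<in> carrier G" unfolding W_def by (rule word_value_append(2)[OF * *])
    show "W t ((x', e') # v) = W t v \<otimes> letter_value G (label_value t K c x', e')"
      unfolding W_def using word_value_append(1)[OF *, of "[(label_value t K c x', e')]"] **
      by (simp add: word_value_def letter_value_def)
  qed
  note Wa = W_Cons[of _ x e u, folded a] W_closed[of _ x e u, folded a]
  have jI: "j \<in> I \<and> c j \<in> carrier G \<and> int j > 0 \<and> c j \<in> A \<and> inv (c j) \<in> A" if "x = Inr j" for j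
  proof -
    have "j \<in> I" using Cons.prems(4) that a by auto
    moreover then have "j \<noteq> 0" using I by metis
    ultimately show ?thesis using I by (auto simp: A_def)
  qed
  show ?case unfolding W_def[symmetric]
  proof (cases "u = []")
    case True
    show "\<exists>s n g bs d i. block_list A ((s, n, g) # bs) \<and>
      (\<forall>t. (\<forall>s. t s \<in> carrier G) \<longrightarrow> W t (a # u) = block_value t ((s, n, g) # bs)) \<and>
      n = d - K * int i \<and> \<bar>d\<bar> \<le> int (length (a # u)) \<and>
      (d > 0 \<longrightarrow> hd (a # u) = (Inl s, True)) \<and> (d < 0 \<longrightarrow> hd (a # u) = (Inl s, False)) \<and>
      (d = 0 \<longrightarrow> hd (a # u) = (Inr i, \<not> s))"
    proof (cases x)
      case (Inl s)
      define d where "d = (if e then 1 else - 1 :: int)"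
      show ?thesis
        apply (rule exI[of _ s], rule exI[of _ d], rule exI[of _ \<one>], rule exI[of _ "[]"],
            rule exI[of _ d], rule exI[of _ 0])
        using True Inl A Wa Cons.prems(4)
        by (auto simp: a block_list_def d_def letter_value_stable W_Nil
            simp del: label_value.simps int_pow_neg_int int_pow_1)
    next
      case (Inr j)
      note j = jI[OF Inr]
      show ?thesis
        apply (rule exI[of _ "\<not> e"], rule exI[of _ "- (K * int j)"],
            rule exI[of _ "if e then c j else inv (c j)"], rule exI[of _ "[(e, K * int j, \<one>)]"],
            rule exI[of _ 0], rule exI[of _ j])
        using True Inr A Wa Cons.prems(4) j K
        by (auto simp: a block_list_def letter_value_spread W_Nil simp del: label_value.simps)
    qed
  next
    case False
    have pre: "reduced_word u" "int (length u) < K" "Inr -` fst ` set u \<subseteq> I"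
      using Cons.prems by (auto simp: reduced_word_def successively_Cons)
    from Cons.IH[OF False this, folded W_def] obtain s n g bs d i where
      ok: "block_list A ((s, n, g) # bs)"
      and val: "\<And>t. \<forall>s. t s \<in> carrier G \<Longrightarrow> W t u = block_value t ((s, n, g) # bs)"
      and n: "n = d - K * int i" and d: "\<bar>d\<bar> \<le> int (length u)"
      and hd: "d > 0 \<Longrightarrow> hd u = (Inl s, True)" "d < 0 \<Longrightarrow> hd u = (Inl s, False)"
          "d = 0 \<Longrightarrow> hd u = (Inr i, \<not> s)"
      by metis
    have red: "\<not> (x = fst (hd u) \<and> e \<noteq> snd (hd u))"
      using Cons.prems(2) False by (simp add: reduced_word_def successively_Cons a)
    have bs: "block_value t bs \<in> carrier G" if "\<forall>s. t s \<in> carrier G" for t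
      using block_value_closed[of t A bs] that A ok by (auto simp: block_list_def)
    have g: "g \<in> carrier G" "g \<in> A" "n \<noteq> 0" using ok A by (auto simp: block_list_def)
    note Wa' = Wa[OF _ Cons.prems(4)]
    show "\<exists>s n g bs d i. block_list A ((s, n, g) # bs) \<and>
      (\<forall>t. (\<forall>s. t s \<in> carrier G) \<longrightarrow> W t (a # u) = block_value t ((s, n, g) # bs)) \<and>
      n = d - K * int i \<and> \<bar>d\<bar> \<le> int (length (a # u)) \<and>
      (d > 0 \<longrightarrow> hd (a # u) = (Inl s, True)) \<and> (d < 0 \<longrightarrow> hd (a # u) = (Inl s, False)) \<and>
      (d = 0 \<longrightarrow> hd (a # u) = (Inr i, \<not> s))"
    proof (cases x)
      case (Inl r)
      define f where "f = (if e then 1 else - 1 :: int)"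
      \<comment> \<open>A stable letter is absorbed by the first block, or it opens a new one.\<close>
      show ?thesis
      proof (cases "r = s")
        case True
        have nz: "d + f \<noteq> 0 \<and> (d + f > 0 \<longleftrightarrow> e) \<and> (d + f < 0 \<longleftrightarrow> \<not> e)"
          using hd red True Inl by (cases d "0 :: int" rule: linorder_cases) (auto simp: f_def)
        have "d + f - K * int i \<noteq> 0"
        proof
          assume "d + f - K * int i = 0"
          moreover have "\<bar>d + f\<bar> < K" using d Cons.prems(3) by (auto simp: f_def)
          ultimately show False using small_multiple_eq[of "d + f" K i 0] nz by simp
        qed
        then have "block_list A ((s, d + f - K * int i, g) # bs)"
          using ok by (auto simp: block_list_def successively_Cons)
        moreover have "W t (a # u) = block_value t ((s, d + f - K * int i, g) # bs)"
          if t: "\<forall>s. t s \<in> carrier G" for t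
        proof -
          have "t s [^] (d + f - K * int i) = t s [^] n \<otimes> t s [^] f"
            using t by (simp add: n int_pow_mult[symmetric] algebra_simps)
          then show ?thesis
            using t g bs[OF t] True Inl by (simp add: Wa'[OF t] val[OF t] letter_value_stable f_def m_assoc
                del: label_value.simps int_pow_neg_int int_pow_1)
        qed
        moreover have "\<bar>d + f\<bar> \<le> int (length (a # u))" using d by (auto simp: f_def)
        ultimately show ?thesis
          using nz Inl True a by (intro exI[of _ s] exI[of _ "d + f - K * int i"] exI[of _ g] exI[of _ bs]
              exI[of _ "d + f"] exI[of _ i]) (auto simp del: block_value.simps)
      next
        case False
        have "block_list A ((r, f, \<one>) # (s, n, g) # bs)"
          using ok A False by (auto simp: block_list_def f_def)
        moreover have "W t (a # u) = block_value t ((r, f, \<one>) # (s, n, g) # bs)"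
          if t: "\<forall>s. t s \<in> carrier G" for t
          using t g bs[OF t] Inl by (simp add: Wa'[OF t] val[OF t] letter_value_stable f_def m_assoc
                del: label_value.simps int_pow_neg_int int_pow_1)
        ultimately show ?thesis
          using Inl a by (intro exI[of _ r] exI[of _ f] exI[of _ \<one>] exI[of _ "(s, n, g) # bs"]
              exI[of _ f] exI[of _ 0]) (auto simp: f_def simp del: block_value.simps)
      qed
    next
      case (Inr j)
      note j = jI[OF Inr]
      let ?c = "if e then c j else inv (c j)"
      have c: "?c \<in> carrier G" "?c \<in> A" using j by auto
      define bs' where "bs' = (if s = e then (e, K * int j + n, g) # bs else (e, K * int j, \<one>) # (s, n, g) # bs)"
      \<comment> \<open>Total cancellation would need \<open>d = 0\<close> and \<open>i = j\<close>: a letter followed by its formal inverse.\<close>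
      have "K * int j + n \<noteq> 0" if "s = e"
      proof
        assume "K * int j + n = 0"
        then have "d = 0" "i = j" using small_multiple_eq[of d K i j] d pre(2) by (auto simp: n)
        then show False using hd(3) red Inr that by simp
      qed
      then have "block_list A ((\<not> e, - (K * int j), ?c) # bs')"
        using ok K j c A by (auto simp: bs'_def block_list_def successively_Cons)
      moreover have "W t (a # u) = block_value t ((\<not> e, - (K * int j), ?c) # bs')"
        if t: "\<forall>s. t s \<in> carrier G" for t
      proof -
        have "t e [^] (K * int j + n) = t e [^] n \<otimes> t e [^] (K * int j)"
            using t by (simp add: int_pow_mult[symmetric] algebra_simps)
        then show ?thesis
          using t g bs[OF t] c j
          by (auto simp add: Inr Wa'[OF t] val[OF t] letter_value_spread bs'_def m_assoc
                simp del: label_value.simps)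
      qed
      ultimately show ?thesis
          using Inr a by (intro exI[of _ "\<not> e"] exI[of _ "- (K * int j)"] exI[of _ ?c] exI[of _ bs']
              exI[of _ 0] exI[of _ j]) (auto simp del: block_value.simps)
    qed
  qed
qed

end

section \<open>Generic elements of a group that moves points freely\<close>

lemma BijGroup_simps:
  shows "carrier (BijGroup \<Omega>) = Bij \<Omega>"
    and "\<lbrakk>f \<in> Bij \<Omega>; g \<in> Bij \<Omega>; p \<in> \<Omega>\<rbrakk> \<Longrightarrow> (f \<otimes>\<^bsub>BijGroup \<Omega>\<^esub> g) p = f (g p)"
    and "p \<in> \<Omega> \<Longrightarrow> \<one>\<^bsub>BijGroup \<Omega>\<^esub> p = p"
  by (simp_all add: BijGroup_def compose_def)

lemma BijGroup_inv_apply: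
  assumes "f \<in> Bij \<Omega>" "p \<in> \<Omega>"
  shows "m_inv (BijGroup \<Omega>) f (f p) = p" "f (m_inv (BijGroup \<Omega>) f p) = p"
  using assms Bij_imp_funcset[OF assms(1)]
  by (auto simp: inv_BijGroup Bij_def bij_betw_def inv_into_f_f f_inv_into_f)

text \<open>
  This is all that the construction of generic elements needs to know about the homeomorphism group:
  points of an invariant set \<open>I\<close> can be moved off any finite set while finitely many other points are
  held fixed.
\<close>

locale movable_action =
  fixes \<Omega> :: "'a set" and H :: "('a \<Rightarrow> 'a) set" and I :: "'a set"
  assumes subgroup: "subgroup H (BijGroup \<Omega>)"
    and I_subset: "I \<subseteq> \<Omega>" and I_nonempty: "I \<noteq> {}"
    and invariant: "\<lbrakk>f \<in> H; q \<in> I\<rbrakk> \<Longrightarrow> f q \<in> I"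
    and movable: "\<lbrakk>q \<in> I; finite F; q \<notin> F; finite B\<rbrakk> \<Longrightarrow>
      \<exists>\<phi>\<in>H. (\<forall>p\<in>F \<inter> \<Omega>. \<phi> p = p) \<and> \<phi> q \<notin> B"
begin

sublocale Sym: group "BijGroup \<Omega>"
  by (rule group_BijGroup)

abbreviation mult_Sym (infixl "\<cdot>" 70) where "f \<cdot> g \<equiv> f \<otimes>\<^bsub>BijGroup \<Omega>\<^esub> g"
abbreviation inv_Sym where "inv_Sym f \<equiv> m_inv (BijGroup \<Omega>) f"

lemma H_Bij: "f \<in> H \<Longrightarrow> f \<in> Bij \<Omega>"
  using subgroup.subset[OF subgroup] by (auto simp: BijGroup_simps)

lemma H_carrier: "f \<in> H \<Longrightarrow> f \<in> carrier (BijGroup \<Omega>)"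
  using H_Bij by (simp add: BijGroup_simps)

lemma H_into: "\<lbrakk>f \<in> H; p \<in> \<Omega>\<rbrakk> \<Longrightarrow> f p \<in> \<Omega>"
  using H_Bij Bij_imp_funcset by blast

lemma H_mult: "\<lbrakk>f \<in> H; g \<in> H\<rbrakk> \<Longrightarrow> f \<cdot> g \<in> H"
  using subgroup.m_closed[OF subgroup] .

lemma H_inv: "f \<in> H \<Longrightarrow> inv_Sym f \<in> H"
  using subgroup.m_inv_closed[OF subgroup] .

lemma H_one: "\<one>\<^bsub>BijGroup \<Omega>\<^esub> \<in> H"
  using subgroup.one_closed[OF subgroup] .

lemma H_mult_apply: "\<lbrakk>f \<in> H; g \<in> H; p \<in> \<Omega>\<rbrakk> \<Longrightarrow> (f \<cdot> g) p = f (g p)"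
  using H_Bij by (simp add: BijGroup_simps)

lemma H_inj: "f \<in> H \<Longrightarrow> inj_on f \<Omega>"
  using H_Bij by (auto simp: Bij_def bij_betw_def)

lemma H_nat_pow: "f \<in> H \<Longrightarrow> f [^]\<^bsub>BijGroup \<Omega>\<^esub> (n :: nat) \<in> H"
  by (induction n) (auto simp: H_one H_mult)

lemma H_int_pow: "f \<in> H \<Longrightarrow> f [^]\<^bsub>BijGroup \<Omega>\<^esub> (n :: int) \<in> H"
  by (cases n rule: int_cases2)
    (simp_all add: H_carrier H_nat_pow H_inv int_pow_int Sym.int_pow_neg_int)

lemma nat_pow_Suc_apply:
  "\<lbrakk>f \<in> H; p \<in> \<Omega>\<rbrakk> \<Longrightarrow> (f [^]\<^bsub>BijGroup \<Omega>\<^esub> Suc n) p = (f [^]\<^bsub>BijGroup \<Omega>\<^esub> n) (f p)"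
  by (simp only: nat_pow_Suc H_mult_apply[OF H_nat_pow])

text \<open>
  The basic modification: an element keeps its values on a finite set \<open>X\<close> of pinned points, while its
  value at one further point avoids finitely many prescribed places.
\<close>

lemma redirect:
  assumes "f \<in> H" "q \<in> I" "finite X" "X \<subseteq> \<Omega>" "q \<notin> X" "finite B"
  obtains f' where "f' \<in> H" "\<And>p. p \<in> X \<Longrightarrow> f' p = f p" "f' q \<notin> B"
proof -
  have "f q \<notin> f ` X"
    using H_inj[OF assms(1)] assms(2,4,5) I_subset by (auto simp: inj_on_def)
  then obtain \<phi> where \<phi>: "\<phi> \<in> H" "\<forall>p\<in>f ` X \<inter> \<Omega>. \<phi> p = p" "\<phi> (f q) \<notin> B"
    using movable[of "f q" "f ` X" B] invariant assms by blast
  show thesis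
  proof (rule that)
    show "\<phi> \<cdot> f \<in> H" using \<phi> assms H_mult by blast
    show "(\<phi> \<cdot> f) p = f p" if "p \<in> X" for p
      using that \<phi> assms H_into by (auto simp: H_mult_apply subset_iff)
    show "(\<phi> \<cdot> f) q \<notin> B"
      using \<phi> assms I_subset by (auto simp: H_mult_apply subset_iff)
  qed
qed

text \<open>
  The orbit of \<open>q\<close> is built one step at a time.  Each step avoids the points pinned so far, so the next
  value is still free, and then pins the point just used.  The final pinned set \<open>X'\<close> determines the whole
  orbit segment, so later modifications that respect \<open>X'\<close> do not change its end point.
\<close>

lemma redirect_nat_pow:
  assumes "f \<in> H" "q \<in> I" "finite X" "X \<subseteq> \<Omega>" "q \<notin> X" "finite B"
  shows "\<exists>f'\<in>H. \<exists>X'. finite X' \<and> X \<subseteq> X' \<and> X' \<subseteq> \<Omega> \<and> (\<forall>p\<in>X. f' p = f p) \<and>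
    (f' [^]\<^bsub>BijGroup \<Omega>\<^esub> Suc n) q \<notin> B \<and>
    (\<forall>h\<in>H. (\<forall>p\<in>X'. h p = f' p) \<longrightarrow>
      (h [^]\<^bsub>BijGroup \<Omega>\<^esub> Suc n) q = (f' [^]\<^bsub>BijGroup \<Omega>\<^esub> Suc n) q)"
  using assms
proof (induction n arbitrary: f q X)
  case 0
  have q: "q \<in> \<Omega>" using 0 I_subset by auto
  obtain f' where f': "f' \<in> H" "\<And>p. p \<in> X \<Longrightarrow> f' p = f p" "f' q \<notin> B"
    using redirect[OF 0] by metis
  have eq: "(h [^]\<^bsub>BijGroup \<Omega>\<^esub> Suc 0) q = h q" if "h \<in> H" for h
    using that H_carrier by simp
  show ?case
  proof (rule bexI[OF _ f'(1)], rule exI[of _ "insert q X"], intro conjI ballI impI)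
    fix h assume "h \<in> H" "\<forall>p\<in>insert q X. h p = f' p"
    then show "(h [^]\<^bsub>BijGroup \<Omega>\<^esub> Suc 0) q = (f' [^]\<^bsub>BijGroup \<Omega>\<^esub> Suc 0) q"
      by (simp only: eq f'(1)) simp
  qed (use f' 0 q in \<open>auto simp only: eq insert_subset finite_insert\<close>)
next
  case (Suc n)
  have q: "q \<in> \<Omega>" using Suc.prems I_subset by auto
  obtain f1 where f1: "f1 \<in> H" "\<And>p. p \<in> X \<Longrightarrow> f1 p = f p" "f1 q \<notin> insert q X"
    using redirect[OF Suc.prems(1-5), of "insert q X"] Suc.prems(3) by auto
  obtain f' X' where f': "f' \<in> H" "finite X'" "insert q X \<subseteq> X'" "X' \<subseteq> \<Omega>"
    "\<forall>p\<in>insert q X. f' p = f1 p" "(f' [^]\<^bsub>BijGroup \<Omega>\<^esub> Suc n) (f1 q) \<notin> B"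
    "\<forall>h\<in>H. (\<forall>p\<in>X'. h p = f' p) \<longrightarrow>
      (h [^]\<^bsub>BijGroup \<Omega>\<^esub> Suc n) (f1 q) = (f' [^]\<^bsub>BijGroup \<Omega>\<^esub> Suc n) (f1 q)"
  proof -
    have "f1 q \<in> I" "finite (insert q X)" "insert q X \<subseteq> \<Omega>" using f1 Suc.prems q invariant by auto
    from Suc.IH[OF f1(1) this f1(3) Suc.prems(6)] that show thesis by (elim bexE exE conjE) assumption+
  qed
  have eq: "(h [^]\<^bsub>BijGroup \<Omega>\<^esub> Suc (Suc n)) q = (h [^]\<^bsub>BijGroup \<Omega>\<^esub> Suc n) (f1 q)"
    if "h \<in> H" "h q = f1 q" for h
    using nat_pow_Suc_apply[OF that(1) q, of "Suc n"] that(2) by simp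
  show ?case
  proof (rule bexI[OF _ f'(1)], rule exI[of _ X'], intro conjI ballI impI)
    show "(f' [^]\<^bsub>BijGroup \<Omega>\<^esub> Suc (Suc n)) q \<notin> B"
      using eq[OF f'(1)] f'(5,6) by simp
    fix h assume h: "h \<in> H" "\<forall>p\<in>X'. h p = f' p"
    then have "h q = f1 q" "f' q = f1 q" using f'(3,5) by auto
    then show "(h [^]\<^bsub>BijGroup \<Omega>\<^esub> Suc (Suc n)) q = (f' [^]\<^bsub>BijGroup \<Omega>\<^esub> Suc (Suc n)) q"
      using eq[OF h(1)] eq[OF f'(1)] f'(7)[rule_format, OF h(1)] h(2) by simp
  qed (use f'(2-5) f1 in auto)
qed

text \<open>
  A negative power of \<open>f\<close> is a positive power of its inverse, whose pinned points are the images
  under \<open>f\<close>.  For this reason \<open>q\<close> has to avoid \<open>f ` X\<close> as well.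
\<close>

lemma redirect_int_pow:
  fixes n :: int
  assumes "f \<in> H" "q \<in> I" "finite X" "X \<subseteq> \<Omega>" "q \<notin> X \<union> f ` X" "finite B" "n \<noteq> 0"
  shows "\<exists>f'\<in>H. \<exists>X'. finite X' \<and> X \<subseteq> X' \<and> X' \<subseteq> \<Omega> \<and> (\<forall>p\<in>X. f' p = f p) \<and>
    (f' [^]\<^bsub>BijGroup \<Omega>\<^esub> n) q \<notin> B \<and>
    (\<forall>h\<in>H. (\<forall>p\<in>X'. h p = f' p) \<longrightarrow>
      (h [^]\<^bsub>BijGroup \<Omega>\<^esub> n) q = (f' [^]\<^bsub>BijGroup \<Omega>\<^esub> n) q)"
proof (cases "n > 0")
  case True
  define m where "m = nat (n - 1)"
  have "n = int (Suc m)" using True by (simp add: m_def)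
  then show ?thesis
    using redirect_nat_pow[of f q X B m] assms(1-6) by (simp only: int_pow_int) blast
next
  case False
  define m where "m = nat (- n - 1)"
  have n: "n = - int (Suc m)" using False assms(7) by (simp add: m_def)
  have pow: "h [^]\<^bsub>BijGroup \<Omega>\<^esub> n = inv_Sym h [^]\<^bsub>BijGroup \<Omega>\<^esub> Suc m" if "h \<in> H" for h
    unfolding n using Sym.int_pow_neg_int[OF H_carrier[OF that], of "Suc m"]
      Sym.nat_pow_inv[OF H_carrier[OF that], of "Suc m"] by (simp only:)
  obtain e Y where e: "e \<in> H" "finite Y" "f ` X \<subseteq> Y" "Y \<subseteq> \<Omega>" "\<forall>p\<in>f ` X. e p = inv_Sym f p"
    "(e [^]\<^bsub>BijGroup \<Omega>\<^esub> Suc m) q \<notin> B"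
    "\<forall>h\<in>H. (\<forall>p\<in>Y. h p = e p) \<longrightarrow>
      (h [^]\<^bsub>BijGroup \<Omega>\<^esub> Suc m) q = (e [^]\<^bsub>BijGroup \<Omega>\<^esub> Suc m) q"
  proof -
    have "f ` X \<subseteq> \<Omega>" using assms H_into by blast
    then show thesis
      using redirect_nat_pow[of "inv_Sym f" q "f ` X" B m] assms(1-6) H_inv that by (metis UnI2 finite_imageI)
  qed
  have inv_e: "inv_Sym (inv_Sym e) = e" using Sym.inv_inv H_carrier e by blast
  have e_f: "e (f p) = p" if "p \<in> X" for p
    using e(5) that assms BijGroup_inv_apply(1)[OF H_Bij] by auto
  \<comment> \<open>What is pinned for \<open>e\<close> at \<open>Y\<close> is pinned for its inverse at \<open>e ` Y\<close>.\<close>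
  show ?thesis
  proof (rule bexI[OF _ H_inv[OF e(1)]], rule exI[of _ "e ` Y"], intro conjI ballI impI)
    show "X \<subseteq> e ` Y" using e(3) e_f by force
    show "e ` Y \<subseteq> \<Omega>" using e(1,4) H_into by blast
    show "inv_Sym e p = f p" if "p \<in> X" for p
      using BijGroup_inv_apply(1)[OF H_Bij[OF e(1)], of "f p"] e_f[OF that] that assms H_into by auto
    show "(inv_Sym e [^]\<^bsub>BijGroup \<Omega>\<^esub> n) q \<notin> B"
      using e(6) pow[OF H_inv[OF e(1)]] inv_e by simp
    fix h assume h: "h \<in> H" "\<forall>p\<in>e ` Y. h p = inv_Sym e p"
    have "inv_Sym h p = e p" if "p \<in> Y" for p
    proof -
      have "h (e p) = p" using h that e(4) BijGroup_inv_apply(1)[OF H_Bij[OF e(1)], of p] by auto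
      then show ?thesis
        using BijGroup_inv_apply(1)[OF H_Bij[OF h(1)], of "e p"] that e(1,4) H_into by auto
    qed
    then show "(h [^]\<^bsub>BijGroup \<Omega>\<^esub> n) q = (inv_Sym e [^]\<^bsub>BijGroup \<Omega>\<^esub> n) q"
      using e(7)[rule_format, OF H_inv[OF h(1)]] pow[OF h(1)] pow[OF H_inv[OF e(1)]] inv_e by simp
  qed (use e(2) in auto)
qed

lemma block_value_in_H:
  assumes "\<And>s. t s \<in> H" "A \<subseteq> H" "\<forall>(s, n, g) \<in> set bs. n \<noteq> 0 \<and> g \<in> A"
  shows "Sym.block_value t bs \<in> H"
  using assms(3) by (induction bs) (use assms in \<open>auto simp: H_one H_mult H_int_pow\<close>)

lemma block_value_Cons_apply:
  assumes "\<And>s. t s \<in> H" "A \<subseteq> H" "\<forall>(s, n, g) \<in> set ((s, n, g) # bs). n \<noteq> 0 \<and> g \<in> A" "p \<in> \<Omega>"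
  shows "Sym.block_value t ((s, n, g) # bs) p = Sym.block_value t bs (g ((t s [^]\<^bsub>BijGroup \<Omega>\<^esub> n) p))"
proof -
  have "Sym.block_value t bs \<in> H" using block_value_in_H[of t A bs] assms by simp
  moreover have "g \<in> H" using assms by auto
  ultimately show ?thesis using assms by (simp add: H_mult_apply H_mult H_int_pow)
qed

text \<open>
  Alternation is what makes the induction work: the end point of the orbit through one block is moved
  off the pinned points of the \<^emph>\<open>other\<close> stable letter, which this block does not change, and hence the
  orbit can be continued freely through the next block.
\<close>

lemma redirect_block_value:
  assumes "block_list A bs" "A \<subseteq> H" "q \<in> I" "finite B"
    and "\<And>s. t s \<in> H \<and> finite (X s) \<and> X s \<subseteq> \<Omega>"
    and "q \<notin> X (fst (hd bs)) \<union> t (fst (hd bs)) ` X (fst (hd bs))"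
  shows "\<exists>t' X'. (\<forall>s. t' s \<in> H \<and> finite (X' s) \<and> X s \<subseteq> X' s \<and> X' s \<subseteq> \<Omega> \<and> (\<forall>p\<in>X s. t' s p = t s p)) \<and>
    Sym.block_value t' bs q \<notin> B \<and>
    (\<forall>h. (\<forall>s. h s \<in> H \<and> (\<forall>p\<in>X' s. h s p = t' s p)) \<longrightarrow>
      Sym.block_value h bs q = Sym.block_value t' bs q)"
  using assms(1,3,5,6)
proof (induction bs arbitrary: q t X)
  case Nil
  then show ?case by (simp add: block_list_def)
next
  case (Cons b bs)
  obtain s n g where b: "b = (s, n, g)" by (cases b)
  have n: "n \<noteq> 0" and g: "g \<in> H" "g \<in> A" using Cons.prems(1) assms(2) by (auto simp: block_list_def b)
  have q: "q \<in> \<Omega>" using Cons.prems I_subset by auto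
  have Ball: "\<forall>(s, n, g) \<in> set (b # bs). n \<noteq> 0 \<and> g \<in> A" using Cons.prems(1) by (simp add: block_list_def)
  \<comment> \<open>The places that the orbit must avoid once the coefficient \<open>g\<close> has been applied.\<close>
  define C where "C = (if bs = [] then B else X (\<not> s) \<union> t (\<not> s) ` X (\<not> s))"
  have "finite C" using assms(4) Cons.prems(3) by (simp add: C_def)
  then have "finite (g -` C \<inter> \<Omega>)" using finite_vimage_IntI[of C g \<Omega>] H_inj g by blast
  then obtain f X1 where f: "f \<in> H" "finite X1" "X s \<subseteq> X1" "X1 \<subseteq> \<Omega>" "\<forall>p\<in>X s. f p = t s p"
    "(f [^]\<^bsub>BijGroup \<Omega>\<^esub> n) q \<notin> g -` C \<inter> \<Omega>"
    "\<forall>h\<in>H. (\<forall>p\<in>X1. h p = f p) \<longrightarrow> (h [^]\<^bsub>BijGroup \<Omega>\<^esub> n) q = (f [^]\<^bsub>BijGroup \<Omega>\<^esub> n) q"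
  proof -
    have "t s \<in> H" "finite (X s)" "X s \<subseteq> \<Omega>" "q \<notin> X s \<union> t s ` X s"
      using Cons.prems(3,4) by (auto simp: b)
    from redirect_int_pow[OF this(1) Cons.prems(2) this(2-4) \<open>finite (g -` C \<inter> \<Omega>)\<close> n] that
    show thesis by (elim bexE exE conjE) assumption+
  qed
  define r where "r = g ((f [^]\<^bsub>BijGroup \<Omega>\<^esub> n) q)"
  have r: "r \<in> I" "r \<notin> C"
    using f(1,6) g Cons.prems(2) q by (auto simp: r_def invariant H_int_pow H_into)
  have eq: "Sym.block_value h (b # bs) q = Sym.block_value h bs r"
    if "\<forall>s. h s \<in> H" "\<forall>p\<in>X1. h s p = f p" for h
  proof -
    have "(h s [^]\<^bsub>BijGroup \<Omega>\<^esub> n) q = (f [^]\<^bsub>BijGroup \<Omega>\<^esub> n) q" using f(7)[rule_format, of "h s"] that by blast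
    then show ?thesis
      using block_value_Cons_apply[of h A s n g bs q] that q Ball assms(2) by (simp add: b r_def)
  qed
  define t1 where "t1 = t(s := f)"
  define Y where "Y = X(s := X1)"
  have tY: "t1 s' \<in> H \<and> finite (Y s') \<and> Y s' \<subseteq> \<Omega>" "X s' \<subseteq> Y s'" "\<forall>p\<in>X s'. t1 s' p = t s' p" for s'
    using f(1-5) Cons.prems(3) by (auto simp: t1_def Y_def)
  show ?case
  proof (cases "bs = []")
    case True
    have "Sym.block_value h (b # bs) q = r"
      if "\<forall>s'. h s' \<in> H" "\<forall>p\<in>X1. h s p = f p" for h
      using eq[OF that] True r(1) I_subset by (auto simp: BijGroup_simps)
    then show ?thesis
      using tY r True by (intro exI[of _ t1] exI[of _ Y]) (auto simp: C_def t1_def Y_def simp del: Sym.block_value.simps)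
  next
    case False
    obtain s' n' g' bs' where bs: "bs = (s', n', g') # bs'" using False by (cases bs) auto
    have s': "s' = (\<not> s)" using Cons.prems(1) by (auto simp: block_list_def b bs)
    have "block_list A bs" using Cons.prems(1) False by (auto simp: block_list_def successively_Cons)
    moreover have "r \<notin> Y (fst (hd bs)) \<union> t1 (fst (hd bs)) ` Y (fst (hd bs))"
      using r(2) False by (simp add: bs s' Y_def t1_def C_def)
    ultimately obtain t' X' where t':
      "\<forall>s. t' s \<in> H \<and> finite (X' s) \<and> Y s \<subseteq> X' s \<and> X' s \<subseteq> \<Omega> \<and> (\<forall>p\<in>Y s. t' s p = t1 s p)"
      "Sym.block_value t' bs r \<notin> B"
      "\<And>h. (\<forall>s. h s \<in> H \<and> (\<forall>p\<in>X' s. h s p = t' s p)) \<Longrightarrow>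
        Sym.block_value h bs r = Sym.block_value t' bs r"
      using Cons.IH[of r t1 Y] tY(1) r(1) by blast
    have X1: "X1 \<subseteq> X' s" "\<forall>p\<in>X1. t' s p = f p" using t'(1)[rule_format, of s] by (auto simp: Y_def t1_def)
    have t'_eq: "Sym.block_value t' (b # bs) q = Sym.block_value t' bs r"
      using eq[of t'] t'(1) X1 by blast
    have "Sym.block_value h (b # bs) q = Sym.block_value t' (b # bs) q"
      if "\<forall>s. h s \<in> H \<and> (\<forall>p\<in>X' s. h s p = t' s p)" for h
    proof -
      have "Sym.block_value h (b # bs) q = Sym.block_value h bs r"
        using that X1 by (intro eq) auto
      then show ?thesis using t'(3)[OF that] t'_eq by (simp only:)
    qed
    moreover have "Sym.block_value t' (b # bs) q \<notin> B"
      using t'(2) t'_eq by (simp only: not_False_eq_True)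
    moreover have "X s \<subseteq> X' s \<and> (\<forall>p\<in>X s. t' s p = t s p)" for s
    proof -
      have "Y s \<subseteq> X' s" "\<forall>p\<in>Y s. t' s p = t1 s p" using t'(1) by blast+
      with tY(2,3)[of s] show ?thesis by (metis subset_iff)
    qed
    ultimately show ?thesis
    proof (intro exI[of _ t'] exI[of _ X'] conjI allI)
      fix s
      show "t' s \<in> H" "finite (X' s)" "X' s \<subseteq> \<Omega>" using t'(1) by simp_all
    qed simp_all
  qed
qed

lemma I_infinite: "infinite I"
proof
  assume "finite I"
  moreover obtain q where "q \<in> I" using I_nonempty by blast
  ultimately obtain \<phi> where "q \<in> I" "\<phi> \<in> H" "\<phi> q \<notin> I"
    using movable[OF _ finite.emptyI empty_iff[THEN iffD1, THEN notI], of q I] by blast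
  then show False using invariant by blast
qed

text \<open>
  The words are treated one after the other, each with a fresh starting point.  The pinned points
  preserve what has been achieved for the earlier ones.
\<close>

theorem simultaneously_nontrivial_values:
  assumes "finite \<W>" "A \<subseteq> H" "\<forall>bs\<in>\<W>. block_list A bs"
  shows "\<exists>t. (\<forall>s. t s \<in> H) \<and> (\<forall>bs\<in>\<W>. \<exists>q\<in>\<Omega>. Sym.block_value t bs q \<noteq> q)"
proof -
  have "\<exists>t X. (\<forall>s. t s \<in> H \<and> finite (X s) \<and> X s \<subseteq> \<Omega>) \<and>
    (\<forall>bs\<in>\<W>. \<exists>q\<in>\<Omega>. \<forall>h. (\<forall>s. h s \<in> H \<and> (\<forall>p\<in>X s. h s p = t s p)) \<longrightarrow> Sym.block_value h bs q \<noteq> q)"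
    using assms(1,3)
  proof (induction \<W>)
    case empty
    then show ?case using H_one by (intro exI[of _ "\<lambda>_. \<one>\<^bsub>BijGroup \<Omega>\<^esub>"] exI[of _ "\<lambda>_. {}"]) auto
  next
    case (insert bs \<W>)
    have "\<forall>bs\<in>\<W>. block_list A bs" using insert.prems by simp
    from insert.IH[OF this] obtain t X where tX: "\<forall>s. t s \<in> H \<and> finite (X s) \<and> X s \<subseteq> \<Omega>" and
      old: "\<forall>bs\<in>\<W>. \<exists>q\<in>\<Omega>. \<forall>h. (\<forall>s. h s \<in> H \<and> (\<forall>p\<in>X s. h s p = t s p)) \<longrightarrow> Sym.block_value h bs q \<noteq> q"
      by (elim exE conjE) (rule that)
    let ?s = "fst (hd bs)"
    have "finite (X ?s \<union> t ?s ` X ?s)" using tX by simp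
    then obtain q where q: "q \<in> I" "q \<notin> X ?s \<union> t ?s ` X ?s"
      using infinite_imp_nonempty[OF Diff_infinite_finite[OF _ I_infinite]] by blast
    obtain t' X' where t':
      "\<forall>s. t' s \<in> H \<and> finite (X' s) \<and> X s \<subseteq> X' s \<and> X' s \<subseteq> \<Omega> \<and> (\<forall>p\<in>X s. t' s p = t s p)"
      "Sym.block_value t' bs q \<notin> {q}"
      "\<forall>h. (\<forall>s. h s \<in> H \<and> (\<forall>p\<in>X' s. h s p = t' s p)) \<longrightarrow>
        Sym.block_value h bs q = Sym.block_value t' bs q"
    proof -
      have "block_list A bs" "finite {q}" using insert.prems by simp_all
      from redirect_block_value[where t = t and X = X, OF this(1) assms(2) q(1) this(2) tX[rule_format] q(2)] that
      show thesis
        by (elim exE conjE) (rule that)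
    qed
    show ?case
    proof (intro exI[of _ t'] exI[of _ X'] conjI ballI)
      fix bs' assume "bs' \<in> insert bs \<W>"
      then consider "bs' = bs" | "bs' \<in> \<W>" by blast
      then show "\<exists>q\<in>\<Omega>. \<forall>h. (\<forall>s. h s \<in> H \<and> (\<forall>p\<in>X' s. h s p = t' s p)) \<longrightarrow> Sym.block_value h bs' q \<noteq> q"
      proof cases
        case 1
        have "q \<in> \<Omega>" using q(1) I_subset by blast
        moreover have "Sym.block_value h bs q \<noteq> q"
          if "\<forall>s. h s \<in> H \<and> (\<forall>p\<in>X' s. h s p = t' s p)" for h
          using t'(2) t'(3)[THEN spec, THEN mp, OF that] by (metis singletonI)
        ultimately show ?thesis using 1 by blast
      next
        case 2
        then obtain q where q: "q \<in> \<Omega>" and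
          q_moved: "\<forall>h. (\<forall>s. h s \<in> H \<and> (\<forall>p\<in>X s. h s p = t s p)) \<longrightarrow> Sym.block_value h bs' q \<noteq> q"
          using old by blast
        have agree: "h s p = t s p" if "\<forall>p\<in>X' s. h s p = t' s p" "p \<in> X s" for h s p
          using t'(1)[rule_format, of s] that by auto
        have "Sym.block_value h bs' q \<noteq> q"
          if "\<forall>s. h s \<in> H \<and> (\<forall>p\<in>X' s. h s p = t' s p)" for h
          by (rule q_moved[rule_format]) (use that agree in blast)
        with q show ?thesis by blast
      qed
    qed (use t'(1) in blast)+
  qed
  then obtain t X where tX: "\<forall>s. t s \<in> H \<and> finite (X s) \<and> X s \<subseteq> \<Omega>"
    and moved: "\<forall>bs\<in>\<W>. \<exists>q\<in>\<Omega>. \<forall>h. (\<forall>s. h s \<in> H \<and> (\<forall>p\<in>X s. h s p = t s p)) \<longrightarrow> Sym.block_value h bs q \<noteq> q"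
    by (elim exE conjE) (rule that)
  have "\<forall>bs\<in>\<W>. \<exists>q\<in>\<Omega>. Sym.block_value t bs q \<noteq> q"
  proof
    fix bs assume "bs \<in> \<W>"
    from bspec[OF moved this] obtain q where "q \<in> \<Omega>" and
      q: "\<forall>h. (\<forall>s. h s \<in> H \<and> (\<forall>p\<in>X s. h s p = t s p)) \<longrightarrow> Sym.block_value h bs q \<noteq> q"
      by (elim bexE) (rule that)
    moreover have "Sym.block_value t bs q \<noteq> q"
      by (rule q[THEN spec, THEN mp]) (use tX in simp)
    ultimately show "\<exists>q\<in>\<Omega>. Sym.block_value t bs q \<noteq> q" by blast
  qed
  moreover have "\<forall>s. t s \<in> H" using tX by blast
  ultimately show ?thesis by (intro exI[of _ t] conjI)
qed

end

section \<open>Continuity of words under uniform convergence\<close>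

text \<open>
  Convergence of points and uniform convergence of maps with respect to an abstract metric.  The
  limit maps of interest are uniformly continuous together with their inverses, because they are
  homeomorphisms of a compact space; this makes uniform convergence pass to inverses and to words.
\<close>

definition point_lim :: "'a metric \<Rightarrow> (nat \<Rightarrow> 'a) \<Rightarrow> 'a \<Rightarrow> bool"
  where "point_lim d x l \<longleftrightarrow> range x \<subseteq> mspace d \<and> l \<in> mspace d \<and> (\<lambda>k. mdist d (x k) l) \<longlonglongrightarrow> 0"

definition unif_lim :: "'a metric \<Rightarrow> (nat \<Rightarrow> 'a \<Rightarrow> 'a) \<Rightarrow> ('a \<Rightarrow> 'a) \<Rightarrow> bool"
  where "unif_lim d f g \<longleftrightarrow> (\<forall>\<epsilon>>0. \<forall>\<^sub>F k in sequentially. \<forall>p\<in>mspace d. mdist d (f k p) (g p) < \<epsilon>)"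

lemma mdist_self: "q \<in> mspace d \<Longrightarrow> mdist d q q = 0"
  by simp

lemma point_lim_const: "q \<in> mspace d \<Longrightarrow> point_lim d (\<lambda>_. q) q"
  by (simp add: point_lim_def image_subset_iff mdist_self)

lemma point_lim_unif_lim_apply:
  assumes f: "unif_lim d f g" and g: "uniformly_continuous_map d d g"
    and x: "point_lim d x l" and maps: "\<And>k. f k \<in> mspace d \<rightarrow> mspace d"
  shows "point_lim d (\<lambda>k. f k (x k)) (g l)"
proof -
  have gM: "g \<in> mspace d \<rightarrow> mspace d" using g by (rule uniformly_continuous_map_funspace)
  have xM: "x k \<in> mspace d" "l \<in> mspace d" for k using x by (auto simp: point_lim_def)
  have "(\<lambda>k. mdist d (g (x k)) (g l)) \<longlonglongrightarrow> 0"
    using ucmap_A[OF g, of x "\<lambda>_. l"] x by (simp add: point_lim_def image_subset_iff)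
  moreover have "(\<lambda>k. mdist d (f k (x k)) (g (x k))) \<longlonglongrightarrow> 0"
  proof (rule tendstoI)
    fix \<epsilon> :: real assume "\<epsilon> > 0"
    then have "\<forall>\<^sub>F k in sequentially. \<forall>p\<in>mspace d. mdist d (f k p) (g p) < \<epsilon>"
      using f by (simp add: unif_lim_def)
    then show "\<forall>\<^sub>F k in sequentially. dist (mdist d (f k (x k)) (g (x k))) 0 < \<epsilon>"
      by eventually_elim (use xM in simp)
  qed
  ultimately have "(\<lambda>k. mdist d (f k (x k)) (g (x k)) + mdist d (g (x k)) (g l)) \<longlonglongrightarrow> 0"
    using tendsto_add by fastforce
  then have "(\<lambda>k. mdist d (f k (x k)) (g l)) \<longlonglongrightarrow> 0"
  proof (rule metric_tendsto_imp_tendsto)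
    show "\<forall>\<^sub>F k in sequentially. dist (mdist d (f k (x k)) (g l)) 0
        \<le> dist (mdist d (f k (x k)) (g (x k)) + mdist d (g (x k)) (g l)) 0"
    proof (rule always_eventually, rule allI)
      fix k
      have "mdist d (f k (x k)) (g l) \<le> mdist d (f k (x k)) (g (x k)) + mdist d (g (x k)) (g l)"
        using maps gM xM by (intro mdist_triangle) auto
      then show "dist (mdist d (f k (x k)) (g l)) 0
        \<le> dist (mdist d (f k (x k)) (g (x k)) + mdist d (g (x k)) (g l)) 0" by simp
    qed
  qed
  then show ?thesis using xM gM maps by (auto simp: point_lim_def)
qed

text \<open>
  If \<open>q = f k p\<close>, then the inverses of \<open>f k\<close> and \<open>g\<close> send \<open>q\<close> to \<open>p\<close> and to the image of \<open>f k p\<close> under the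
  inverse of \<open>g\<close>.  The latter is close to \<open>p\<close>, because \<open>f k p\<close> is close to \<open>g p\<close>.
\<close>

lemma unif_lim_inv:
  assumes f: "unif_lim d f g" and bij: "\<And>k. f k \<in> Bij (mspace d)" "g \<in> Bij (mspace d)"
    and g: "uniformly_continuous_map d d (m_inv (BijGroup (mspace d)) g)"
  shows "unif_lim d (\<lambda>k. m_inv (BijGroup (mspace d)) (f k)) (m_inv (BijGroup (mspace d)) g)"
  unfolding unif_lim_def
proof (intro allI impI)
  let ?inv = "m_inv (BijGroup (mspace d))"
  fix \<epsilon> :: real assume "\<epsilon> > 0"
  then obtain \<delta> where \<delta>: "\<delta> > 0"
    "\<forall>x\<in>mspace d. \<forall>y\<in>mspace d. mdist d y x < \<delta> \<longrightarrow> mdist d (?inv g y) (?inv g x) < \<epsilon>"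
    using g unfolding uniformly_continuous_map_def by blast
  then have "\<forall>\<^sub>F k in sequentially. \<forall>p\<in>mspace d. mdist d (f k p) (g p) < \<delta>"
    using f by (simp add: unif_lim_def)
  then show "\<forall>\<^sub>F k in sequentially. \<forall>p\<in>mspace d. mdist d (?inv (f k) p) (?inv g p) < \<epsilon>"
  proof (eventually_elim, intro ballI)
    fix k q assume k: "\<forall>p\<in>mspace d. mdist d (f k p) (g p) < \<delta>" and q: "q \<in> mspace d"
    define p where "p = ?inv (f k) q"
    have p: "p \<in> mspace d" "f k p = q"
      using BijGroup_inv_apply(2)[OF bij(1) q] Bij_inv_into_mem[OF bij(1) q] q
      by (auto simp: p_def inv_BijGroup[OF bij(1)])
    have gp: "g p \<in> mspace d" using Bij_imp_funcset[OF bij(2)] p by auto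
    have "mdist d (g p) (f k p) < \<delta>" using k[rule_format, OF p(1)] by (simp only: mdist_commute[of d "g p"])
    then have "mdist d (?inv g (g p)) (?inv g (f k p)) < \<epsilon>" using \<delta>(2) p q gp by simp
    then show "mdist d (?inv (f k) q) (?inv g q) < \<epsilon>"
      using BijGroup_inv_apply(1)[OF bij(2) p(1)] p by (simp add: p_def)
  qed
qed

definition bi_uniform :: "'a metric \<Rightarrow> ('a \<Rightarrow> 'a) set"
  where "bi_uniform d = {f \<in> Bij (mspace d). uniformly_continuous_map d d f \<and>
    uniformly_continuous_map d d (m_inv (BijGroup (mspace d)) f)}"

context
  fixes d :: "'a metric"
begin

interpretation Sym: group "BijGroup (mspace d)"
  by (rule group_BijGroup)

lemma point_lim_nat_pow:
  fixes n :: nat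
  assumes "unif_lim d f g" "\<And>k. f k \<in> Bij (mspace d)" "g \<in> Bij (mspace d)"
    "uniformly_continuous_map d d g" "point_lim d x l"
  shows "point_lim d (\<lambda>k. (f k [^]\<^bsub>BijGroup (mspace d)\<^esub> n) (x k)) ((g [^]\<^bsub>BijGroup (mspace d)\<^esub> n) l)"
  using assms(5)
proof (induction n arbitrary: x l)
  case 0
  then have "x k \<in> mspace d" "l \<in> mspace d" for k by (auto simp: point_lim_def)
  then show ?case using 0 by (simp add: BijGroup_simps)
next
  case (Suc n)
  have M: "x k \<in> mspace d" "l \<in> mspace d" for k using Suc.prems by (auto simp: point_lim_def)
  have pow: "h [^]\<^bsub>BijGroup (mspace d)\<^esub> n \<in> Bij (mspace d)" if "h \<in> Bij (mspace d)" for h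
    using Sym.nat_pow_closed[of h n] that by (simp add: BijGroup_simps)
  have "point_lim d (\<lambda>k. f k (x k)) (g l)"
    by (rule point_lim_unif_lim_apply[OF assms(1,4) Suc.prems Bij_imp_funcset[OF assms(2)]])
  from Suc.IH[OF this] show ?case
    using M pow assms by (simp add: BijGroup_simps)
qed

lemma point_lim_int_pow:
  fixes n :: int
  assumes f: "unif_lim d f g" "\<And>k. f k \<in> Bij (mspace d)" and g: "g \<in> bi_uniform d"
    and x: "point_lim d x l"
  shows "point_lim d (\<lambda>k. (f k [^]\<^bsub>BijGroup (mspace d)\<^esub> n) (x k)) ((g [^]\<^bsub>BijGroup (mspace d)\<^esub> n) l)"
proof (cases n rule: int_cases2)
  case (nonneg m)
  then show ?thesis using point_lim_nat_pow[of f g x l m] assms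
    by (simp only: bi_uniform_def int_pow_int mem_Collect_eq)
next
  case (nonpos m)
  let ?inv = "m_inv (BijGroup (mspace d))"
  have inv: "?inv h \<in> Bij (mspace d)" if "h \<in> Bij (mspace d)" for h
    using Sym.inv_closed[of h] that by (simp add: BijGroup_simps)
  have pow: "h [^]\<^bsub>BijGroup (mspace d)\<^esub> n = ?inv h [^]\<^bsub>BijGroup (mspace d)\<^esub> m"
    if "h \<in> Bij (mspace d)" for h
    using that by (simp add: nonpos Sym.int_pow_neg_int Sym.nat_pow_inv BijGroup_simps)
  have "point_lim d (\<lambda>k. (?inv (f k) [^]\<^bsub>BijGroup (mspace d)\<^esub> m) (x k))
      ((?inv g [^]\<^bsub>BijGroup (mspace d)\<^esub> m) l)"
    using f g x inv by (intro point_lim_nat_pow unif_lim_inv) (auto simp: bi_uniform_def)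
  then show ?thesis using pow f(2) g by (simp add: bi_uniform_def)
qed

lemma block_value_Bij:
  assumes "\<And>s. t s \<in> Bij (mspace d)" "A \<subseteq> Bij (mspace d)" "\<forall>(s, n, g) \<in> set bs. n \<noteq> 0 \<and> g \<in> A"
  shows "Sym.block_value t bs \<in> Bij (mspace d)"
  using Sym.block_value_closed[of t A bs] assms by (simp add: BijGroup_simps)

text \<open>
  The value of a word at a point depends continuously on the stable letters.  Hence the condition that
  a word moves some point is open, and elements of a dense subgroup can be chosen to satisfy it.
\<close>

lemma point_lim_block_value:
  assumes f: "\<And>s. unif_lim d (\<lambda>k. f k s) (t s)" "\<And>s k. f k s \<in> Bij (mspace d)"
    and t: "\<And>s. t s \<in> bi_uniform d"
    and A: "A \<subseteq> bi_uniform d" "\<forall>(s, n, g) \<in> set bs. n \<noteq> 0 \<and> g \<in> A"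
    and x: "point_lim d x l"
  shows "point_lim d (\<lambda>k. Sym.block_value (f k) bs (x k)) (Sym.block_value t bs l)"
  using A(2) x
proof (induction bs arbitrary: x l)
  case Nil
  then have "x k \<in> mspace d" "l \<in> mspace d" for k by (auto simp: point_lim_def)
  then show ?case using Nil by (simp add: BijGroup_simps)
next
  case (Cons b bs)
  obtain s n g where b: "b = (s, n, g)" by (cases b)
  have g: "g \<in> bi_uniform d" using Cons.prems A(1) by (auto simp: b)
  have gB: "g \<in> Bij (mspace d)" using g by (simp add: bi_uniform_def)
  have AB: "A \<subseteq> Bij (mspace d)" using A(1) by (auto simp: bi_uniform_def)
  have pow: "h [^]\<^bsub>BijGroup (mspace d)\<^esub> n \<in> Bij (mspace d)" if "h \<in> Bij (mspace d)" for h
    using Sym.int_pow_closed[of h n] that by (simp add: BijGroup_simps)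
  have eq: "Sym.block_value h (b # bs) p = Sym.block_value h bs (g ((h s [^]\<^bsub>BijGroup (mspace d)\<^esub> n) p))"
    if h: "\<And>s. h s \<in> Bij (mspace d)" and p: "p \<in> mspace d" for h p
  proof -
    have "Sym.block_value h bs \<in> Bij (mspace d)" using block_value_Bij[of h A bs] h AB Cons.prems by simp
    moreover have "g \<otimes>\<^bsub>BijGroup (mspace d)\<^esub> h s [^]\<^bsub>BijGroup (mspace d)\<^esub> n \<in> Bij (mspace d)"
      using Sym.m_closed gB pow[OF h] by (simp add: BijGroup_simps)
    ultimately show ?thesis using h p gB pow[OF h] by (simp add: b BijGroup_simps)
  qed
  have "point_lim d (\<lambda>k. (f k s [^]\<^bsub>BijGroup (mspace d)\<^esub> n) (x k)) ((t s [^]\<^bsub>BijGroup (mspace d)\<^esub> n) l)"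
    using f t Cons.prems by (intro point_lim_int_pow) auto
  moreover have "unif_lim d (\<lambda>_. g) g"
    using Bij_imp_funcset[OF gB, THEN funcset_mem] by (simp add: unif_lim_def mdist_self)
  moreover have "uniformly_continuous_map d d g" using g by (simp add: bi_uniform_def)
  ultimately have "point_lim d (\<lambda>k. g ((f k s [^]\<^bsub>BijGroup (mspace d)\<^esub> n) (x k))) (g ((t s [^]\<^bsub>BijGroup (mspace d)\<^esub> n) l))"
    by (intro point_lim_unif_lim_apply[where f = "\<lambda>_. g"] Bij_imp_funcset[OF gB])
  from Cons.IH[OF _ this] Cons.prems(1)
  have "point_lim d (\<lambda>k. Sym.block_value (f k) bs (g ((f k s [^]\<^bsub>BijGroup (mspace d)\<^esub> n) (x k))))
     (Sym.block_value t bs (g ((t s [^]\<^bsub>BijGroup (mspace d)\<^esub> n) l)))" by simp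
  moreover have "x k \<in> mspace d" "l \<in> mspace d" for k using Cons.prems by (auto simp: point_lim_def)
  moreover have "t s \<in> Bij (mspace d)" for s using t by (simp add: bi_uniform_def)
  ultimately show ?case using eq f(2) by presburger
qed

end

section \<open>Girth of dense subgroups\<close>

lemma word_value_subgroup:
  assumes "group G" "subgroup H G" "fst ` set w \<subseteq> H"
  shows "word_value (G\<lparr>carrier := H\<rparr>) w = word_value G w"
  using assms(3)
proof (induction w)
  case Nil
  then show ?case by (simp add: word_value_def)
next
  case (Cons a w)
  then show ?case
    using group.m_inv_consistent[OF assms(1,2)] by (simp add: word_value_def letter_value_def)
qed

text \<open>
  No old generator is lost, because the stable letters that wrap it are generators themselves.
\<close>

lemma (in group) generate_spread:
  assumes t: "\<And>s. t s \<in> carrier G" and c: "c ` I \<subseteq> carrier G"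
  shows "generate G (c ` I) \<subseteq> generate G (label_value t K c ` (range Inl \<union> Inr ` I))"
proof (rule generate_subgroup_incl)
  let ?S = "label_value t K c ` (range Inl \<union> Inr ` I)"
  have S: "?S \<subseteq> carrier G"
  proof (intro image_subsetI label_value_closed t)
    fix a i assume "a \<in> range Inl \<union> Inr ` I" "Inr i = a"
    then show "c i \<in> carrier G" using c by auto
  qed
  interpret S: subgroup "generate G ?S" G by (rule generate_is_subgroup[OF S])
  have ts: "t s [^] (n :: int) \<in> generate G ?S" for s n
  proof (rule subgroup_int_pow_closed[OF S.subgroup_axioms], rule generate.incl)
    have "label_value t K c (Inl s) \<in> ?S" by (intro imageI) simp
    then show "t s \<in> ?S" by simp
  qed
  show "c ` I \<subseteq> generate G ?S"
  proof
    fix g assume "g \<in> c ` I"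
    then obtain i where i: "i \<in> I" "g = c i" by blast
    then have ci: "c i \<in> carrier G" using c by blast
    let ?p = "t True [^] (K * int i)" and ?q = "t False [^] (K * int i)"
    have "label_value t K c (Inr i) \<in> ?S" using i by (intro imageI) simp
    then have "?p \<otimes> c i \<otimes> inv ?q \<in> ?S" using t by (simp add: int_pow_neg)
    then have "inv ?p \<otimes> (?p \<otimes> c i \<otimes> inv ?q) \<otimes> ?q \<in> generate G ?S"
      by (rule S.m_closed[OF S.m_closed[OF S.m_inv_closed[OF ts] generate.incl] ts])
    moreover have "inv ?p \<otimes> (?p \<otimes> c i \<otimes> inv ?q) \<otimes> ?q = c i"
      using t ci by (simp add: m_assoc inv_solve_left')
    ultimately show "g \<in> generate G ?S" by (simp add: i)
  qed
  show "subgroup (generate G ?S) G" by (rule S.subgroup_axioms)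
qed

lemma enat_eq_infinityI: "(\<And>m. enat m \<le> x) \<Longrightarrow> x = \<infinity>"
  by (metis enat_ord_simps(1) not_less_eq_eq order_refl not_enat_eq)

text \<open>
  For each \<open>m\<close> there is a generating set without relations of length at most \<open>m\<close>.  The choice
  \<open>K = m + 1\<close> gives block forms for the finitely many label words in question; the stable letters are
  first found in \<open>H\<close> and then approximated by elements of \<open>\<Gamma>\<close>.
\<close>

theorem (in movable_action) girth_dense_subgroup:
  fixes d :: "'a metric"
  assumes \<Omega>: "\<Omega> = mspace d"
    and \<Gamma>: "subgroup \<Gamma> (BijGroup \<Omega>)" "\<Gamma> \<subseteq> H"
    and uniform: "H \<subseteq> bi_uniform d"
    and dense: "\<And>f \<epsilon>. \<lbrakk>f \<in> H; \<epsilon> > 0\<rbrakk> \<Longrightarrow> \<exists>\<gamma>\<in>\<Gamma>. \<forall>p\<in>\<Omega>. mdist d (\<gamma> p) (f p) < \<epsilon>"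
    and S: "finite_generating_set (BijGroup \<Omega>\<lparr>carrier := \<Gamma>\<rparr>) S"
  shows "girth (BijGroup \<Omega>\<lparr>carrier := \<Gamma>\<rparr>) = \<infinity>"
proof (rule enat_eq_infinityI)
  fix m :: nat
  let ?B = "BijGroup \<Omega>" and ?G = "BijGroup \<Omega>\<lparr>carrier := \<Gamma>\<rparr>"
  define K where "K = int m + 1"
  have \<Gamma>B: "\<Gamma> \<subseteq> carrier ?B" using \<Gamma> H_carrier by blast
  have S': "finite S" "S \<subseteq> \<Gamma>" "generate ?B S = \<Gamma>"
    using S Sym.generate_consistent[OF _ \<Gamma>(1), of S] by (auto simp: finite_generating_set_def)
  obtain c where c: "c ` {1..card S} = S"
    using ex_bij_betw_nat_finite_1[OF S'(1)] by (auto simp: bij_betw_def)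
  define I where "I = {1..card S}"
  have cI: "c ` I = S" "0 \<notin> I" "finite I" using c by (auto simp: I_def)
  define A where "A = {\<one>\<^bsub>?B\<^esub>} \<union> c ` I \<union> m_inv ?B ` c ` I"
  have A: "A \<subseteq> \<Gamma>" using S' subgroup.one_closed[OF \<Gamma>(1)] subgroup.m_inv_closed[OF \<Gamma>(1)]
    by (auto simp: A_def cI)
  define L :: "(bool + nat) set" where "L = range Inl \<union> Inr ` I"
  define U where "U = {u :: (bool + nat) letter list. u \<noteq> [] \<and> reduced_word u \<and> length u \<le> m \<and> fst ` set u \<subseteq> L}"
  have "finite (L \<times> (UNIV :: bool set))" using cI by (simp add: L_def)
  then have "finite {u. set u \<subseteq> L \<times> (UNIV :: bool set) \<and> length u \<le> m}" by (rule finite_lists_length_le)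
  then have "finite U" by (rule finite_subset[rotated]) (force simp: U_def)
  have "\<forall>u\<in>U. \<exists>bs. block_list A bs \<and> (\<forall>t. (\<forall>s. t s \<in> carrier ?B) \<longrightarrow>
      word_value ?B (map (\<lambda>(a, e). (Sym.label_value t K c a, e)) (rev u)) = Sym.block_value t bs)"
  proof
    fix u assume u: "u \<in> U"
    have "u \<noteq> []" "reduced_word u" "int (length u) < K" using u by (auto simp: U_def K_def)
    moreover have "Inr -` fst ` set u \<subseteq> I" using u by (auto simp: U_def L_def)
    moreover have "c ` I \<subseteq> carrier ?B" using cI S' \<Gamma>B by simp
    ultimately show "\<exists>bs. block_list A bs \<and> (\<forall>t. (\<forall>s. t s \<in> carrier ?B) \<longrightarrow>
        word_value ?B (map (\<lambda>(a, e). (Sym.label_value t K c a, e)) (rev u)) = Sym.block_value t bs)"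
      using Sym.block_form_exists[of u K I c] cI(2) unfolding A_def by blast
  qed
  from bchoice[OF this] obtain bl where bl: "\<And>u. u \<in> U \<Longrightarrow> block_list A (bl u)"
    "\<And>u t. \<lbrakk>u \<in> U; \<forall>s. t s \<in> carrier ?B\<rbrakk> \<Longrightarrow>
      word_value ?B (map (\<lambda>(a, e). (Sym.label_value t K c a, e)) (rev u)) = Sym.block_value t (bl u)"
    by blast
  have "finite (bl ` U)" "A \<subseteq> H" "\<forall>bs\<in>bl ` U. block_list A bs"
    using \<open>finite U\<close> A \<Gamma>(2) bl(1) by auto
  from simultaneously_nontrivial_values[OF this] obtain t where t: "\<And>s. t s \<in> H"
    and nontriv: "\<And>bs. bs \<in> bl ` U \<Longrightarrow> \<exists>q\<in>\<Omega>. Sym.block_value t bs q \<noteq> q" by blast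
  have "\<forall>k s. \<exists>\<gamma>\<in>\<Gamma>. \<forall>p\<in>\<Omega>. mdist d (\<gamma> p) (t s p) < inverse (real (Suc k))"
    using dense[OF t] by simp
  then obtain f where f: "\<And>k s. f k s \<in> \<Gamma>"
    "\<And>k s p. p \<in> \<Omega> \<Longrightarrow> mdist d (f k s p) (t s p) < inverse (real (Suc k))"
    by metis
  have f_lim: "unif_lim d (\<lambda>k. f k s) (t s)" for s
    unfolding unif_lim_def
  proof (intro allI impI)
    fix \<epsilon> :: real assume "\<epsilon> > 0"
    with LIMSEQ_inverse_real_of_nat have "\<forall>\<^sub>F k in sequentially. inverse (real (Suc k)) < \<epsilon>"
      by (rule order_tendstoD(2))
    then show "\<forall>\<^sub>F k in sequentially. \<forall>p\<in>mspace d. mdist d (f k s p) (t s p) < \<epsilon>"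
      by eventually_elim (use f(2) \<Omega> in \<open>force intro: less_trans\<close>)
  qed
  have f_Bij: "f k s \<in> Bij \<Omega>" for k s using f(1) \<Gamma>B by (auto simp: BijGroup_simps)
  have "\<forall>bs\<in>bl ` U. \<forall>\<^sub>F k in sequentially. \<exists>q\<in>\<Omega>. Sym.block_value (f k) bs q \<noteq> q"
  proof
    fix bs assume bs: "bs \<in> bl ` U"
    obtain q where q: "q \<in> \<Omega>" "Sym.block_value t bs q \<noteq> q" using nontriv[OF bs] by blast
    have "point_lim d (\<lambda>k. Sym.block_value (f k) bs q) (Sym.block_value t bs q)"
      unfolding \<Omega>
    proof (rule point_lim_block_value[OF f_lim])
      show "A \<subseteq> bi_uniform d" using \<open>A \<subseteq> H\<close> uniform by blast
      show "\<forall>(s, n, g)\<in>set bs. n \<noteq> 0 \<and> g \<in> A"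
        using bspec[OF \<open>\<forall>bs\<in>bl ` U. block_list A bs\<close> bs] by (simp add: block_list_def)
      show "point_lim d (\<lambda>k. q) q" using q(1) \<Omega> by (simp add: point_lim_const)
    qed (use f_Bij t uniform \<Omega> in auto)
    then have lim: "(\<lambda>k. mdist d (Sym.block_value (f k) bs q) (Sym.block_value t bs q)) \<longlonglongrightarrow> 0"
      and M: "Sym.block_value t bs q \<in> mspace d"
      by (auto simp: point_lim_def)
    have "mdist d q (Sym.block_value t bs q) > 0"
    proof -
      have "mdist d q (Sym.block_value t bs q) \<noteq> 0" using q M \<Omega> by simp
      then show ?thesis using mdist_nonneg[of d q "Sym.block_value t bs q"] by linarith
    qed
    from order_tendstoD(2)[OF lim this]
    show "\<forall>\<^sub>F k in sequentially. \<exists>q\<in>\<Omega>. Sym.block_value (f k) bs q \<noteq> q"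
      by eventually_elim (use q in force)
  qed
  with \<open>finite (bl ` U)\<close> have "\<forall>\<^sub>F k in sequentially. \<forall>bs\<in>bl ` U. \<exists>q\<in>\<Omega>. Sym.block_value (f k) bs q \<noteq> q"
    by (rule eventually_ball_finite)
  then obtain k where k: "\<forall>bs\<in>bl ` U. \<exists>q\<in>\<Omega>. Sym.block_value (f k) bs q \<noteq> q"
    by (rule eventually_happens'[OF sequentially_bot, THEN exE]) (rule that)
  define T where "T = Sym.label_value (f k) K c ` L"
  have fk: "\<And>s. f k s \<in> carrier ?B" using f(1) \<Gamma>B by blast
  have lab: "Sym.label_value (f k) K c a \<in> \<Gamma>" if "a \<in> L" for a
  proof (cases a)
    case (Inl s)
    then show ?thesis using f by simp
  next
    case (Inr i)
    then have "c i \<in> \<Gamma>" using that cI S' by (auto simp: L_def)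
    then show ?thesis
      using f(1) Inr subgroup.m_closed[OF \<Gamma>(1)] Sym.subgroup_int_pow_closed[OF \<Gamma>(1)] by simp
  qed
  have "finite_generating_set ?G T"
    unfolding finite_generating_set_def
  proof (intro conjI)
    show "finite T" using cI by (simp add: T_def L_def)
    show T\<Gamma>: "T \<subseteq> carrier ?G" using lab by (auto simp: T_def)
    have "\<Gamma> \<subseteq> generate ?B T"
      using Sym.generate_spread[OF fk, where c = c and I = I and K = K] S' \<Gamma>B cI by (simp add: T_def L_def)
    moreover have "generate ?B T \<subseteq> \<Gamma>"
      using T\<Gamma> by (intro Sym.generate_subgroup_incl \<Gamma>) simp
    ultimately show "generate ?G T = carrier ?G"
      using Sym.generate_consistent[OF _ \<Gamma>(1), of T] T\<Gamma> by simp
  qed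
  moreover have "enat m \<le> girth_wrt ?G T"
    unfolding girth_wrt_def
  proof (rule INF_greatest)
    fix w assume w: "w \<in> relations ?G T"
    have wT: "fst ` set w \<subseteq> T" and red: "reduced_word w" and "w \<noteq> []" and "word_value ?G w = \<one>\<^bsub>?B\<^esub>"
      using w by (auto simp: relations_def)
    have "T \<subseteq> \<Gamma>" using lab by (auto simp: T_def)
    then have one: "word_value ?B w = \<one>\<^bsub>?B\<^esub>"
      using word_value_subgroup[OF Sym.group_axioms \<Gamma>(1), of w] wT \<open>word_value ?G w = _\<close> by auto
    \<comment> \<open>The relation is lifted to labels; choosing one label for each value keeps it reduced.\<close>
    have "\<forall>s\<in>T. \<exists>a. a \<in> L \<and> Sym.label_value (f k) K c a = s" by (auto simp: T_def)
    from bchoice[OF this] obtain lb where lb: "\<And>s. s \<in> T \<Longrightarrow> lb s \<in> L \<and> Sym.label_value (f k) K c (lb s) = s"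
      by blast
    define u where "u = rev (map (\<lambda>(s, e). (lb s, e)) w)"
    have u: "map (\<lambda>(a, e). (Sym.label_value (f k) K c a, e)) (rev u) = w"
      unfolding u_def rev_rev_ident map_map by (rule map_idI) (use wT lb in auto)
    show "enat m \<le> enat (length w)"
    proof (rule ccontr)
      assume "\<not> enat m \<le> enat (length w)"
      then have "length u \<le> m" by (simp add: u_def)
      moreover have "reduced_word u"
      proof -
        have "successively (\<lambda>a b. \<not> (fst a = fst b \<and> snd a \<noteq> snd b)) (map (\<lambda>(s, e). (lb s, e)) w)"
          unfolding successively_map
        proof (rule successively_mono[OF red[unfolded reduced_word_def]])
          fix a b assume "a \<in> set w" "b \<in> set w" and ab: "\<not> (fst a = fst b \<and> snd a \<noteq> snd b)"
          then have "fst a \<in> T" "fst b \<in> T" using wT by auto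
          then have "lb (fst a) = lb (fst b) \<Longrightarrow> fst a = fst b" using lb by metis
          with ab show "\<not> (fst (case a of (s, e) \<Rightarrow> (lb s, e)) = fst (case b of (s, e) \<Rightarrow> (lb s, e)) \<and>
            snd (case a of (s, e) \<Rightarrow> (lb s, e)) \<noteq> snd (case b of (s, e) \<Rightarrow> (lb s, e)))"
            by (auto simp: split_beta)
        qed
        then show ?thesis by (auto simp: reduced_word_def u_def successively_rev elim: successively_mono)
      qed
      moreover have "fst ` set u \<subseteq> L" "u \<noteq> []" using wT lb \<open>w \<noteq> []\<close> by (auto simp: u_def)
      ultimately have "u \<in> U" by (simp add: U_def)
      then have "Sym.block_value (f k) (bl u) = \<one>\<^bsub>?B\<^esub>"
        using bl(2)[of u "f k"] fk one u by simp
      then show False using k \<open>u \<in> U\<close> by (force simp: BijGroup_simps)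
    qed
  qed
  ultimately show "enat m \<le> girth ?G"
    unfolding girth_def by (intro SUP_upper2[of T]) auto
qed

section \<open>Pushing points in Euclidean space\<close>

definition l1_distance :: "nat \<Rightarrow> (nat \<Rightarrow> real) \<Rightarrow> (nat \<Rightarrow> real) \<Rightarrow> real"
  where "l1_distance n v c = (\<Sum>i<n. \<bar>v i - c i\<bar>)"

text \<open>
  A homeomorphism of Euclidean space that is supported in the closed \<open>l1\<close>-ball of radius \<open>r\<close> around \<open>c\<close>.
  It changes the coordinate \<open>0\<close> only and moves points along it by the multiple \<open>s\<close> of a bump function
  that is 1-Lipschitz in this coordinate; for \<open>\<bar>s\<bar> < 1\<close> it is therefore strictly increasing on each line
  in this direction.
\<close>

definition push :: "nat \<Rightarrow> (nat \<Rightarrow> real) \<Rightarrow> real \<Rightarrow> real \<Rightarrow> (nat \<Rightarrow> real) \<Rightarrow> nat \<Rightarrow> real"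
  where "push n c r s v = v(0 := v 0 + s * max 0 (r - l1_distance n v c))"

lemma Euclidean_ball_in_open:
  assumes "openin (Euclidean_space n) W" "c \<in> W"
  shows "\<exists>r>0. \<forall>v\<in>topspace (Euclidean_space n). l1_distance n v c \<le> r \<longrightarrow> v \<in> W"
proof -
  obtain T where T: "openin (powertop_real UNIV) T" "W = T \<inter> {x. \<forall>i\<ge>n. x i = 0}"
    using assms(1) by (auto simp: Euclidean_space_def openin_subtopology)
  have cT: "c \<in> T" "\<forall>i\<ge>n. c i = 0" using assms(2) T by auto
  obtain X where X: "c \<in> (\<Pi>\<^sub>E i\<in>UNIV. X i)" "\<forall>i. open (X i)" "(\<Pi>\<^sub>E i\<in>UNIV. X i) \<subseteq> T"
    using product_topology_open_contains_basis[OF T(1) cT(1)] by auto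
  have "\<forall>i. \<exists>e>0. \<forall>y. \<bar>y - c i\<bar> < e \<longrightarrow> y \<in> X i"
  proof
    fix i
    have "c i \<in> X i" "open (X i)" using X by auto
    then show "\<exists>e>0. \<forall>y. \<bar>y - c i\<bar> < e \<longrightarrow> y \<in> X i" by (auto simp: open_dist dist_real_def)
  qed
  then obtain e where e: "\<And>i. e i > 0" "\<And>i y. \<bar>y - c i\<bar> < e i \<Longrightarrow> y \<in> X i" by metis
  define r where "r = Min (insert 1 (e ` {..<n})) / 2"
  have r: "r > 0" using e(1) by (simp add: r_def)
  have r_less: "r < e i" if "i < n" for i
  proof -
    have "Min (insert 1 (e ` {..<n})) \<le> e i" using that by (intro Min_le) auto
    then show ?thesis using r unfolding r_def by linarith
  qed
  have "v \<in> W" if v: "v \<in> topspace (Euclidean_space n)" "l1_distance n v c \<le> r" for v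
  proof -
    have v0: "\<forall>i\<ge>n. v i = 0" using v by (simp add: topspace_Euclidean_space)
    have "v i \<in> X i" for i
    proof (cases "i < n")
      case True
      then have "\<bar>v i - c i\<bar> \<le> l1_distance n v c"
        unfolding l1_distance_def by (intro member_le_sum) auto
      then show ?thesis using e(2) r_less[OF True] v(2) by force
    next
      case False
      then show ?thesis using v0 cT X(1) by (metis PiE_mem UNIV_I not_less)
    qed
    then have "v \<in> T" using X(3) by auto
    then show ?thesis using v0 T(2) by simp
  qed
  then show ?thesis using r by blast
qed

lemma l1_distance_upd:
  assumes "0 < n"
  shows "l1_distance n (v(0 := y)) c = l1_distance n v c + \<bar>y - c 0\<bar> - \<bar>v 0 - c 0\<bar>"
proof -
  have split: "l1_distance n w c = \<bar>w 0 - c 0\<bar> + (\<Sum>i\<in>{..<n} - {0}. \<bar>w i - c i\<bar>)" for w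
    unfolding l1_distance_def using assms by (subst sum.remove[of _ 0]) auto
  have "(\<Sum>i\<in>{..<n} - {0}. \<bar>(v(0 := y)) i - c i\<bar>) = (\<Sum>i\<in>{..<n} - {0}. \<bar>v i - c i\<bar>)"
    by (intro sum.cong) auto
  then show ?thesis by (simp add: split)
qed

lemma push_topspace:
  "0 < n \<Longrightarrow> v \<in> topspace (Euclidean_space n) \<Longrightarrow> push n c r s v \<in> topspace (Euclidean_space n)"
  by (simp add: push_def topspace_Euclidean_space)

lemma push_outside: "r \<le> l1_distance n v c \<Longrightarrow> push n c r s v = v"
  by (simp add: push_def)

lemma push_inside:
  assumes "0 < n" "l1_distance n v c \<le> r" "\<bar>s\<bar> \<le> 1"
  shows "l1_distance n (push n c r s v) c \<le> r"
proof -
  let ?b = "r - l1_distance n v c"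
  have "\<bar>s * ?b\<bar> \<le> ?b" using assms(2,3) by (simp add: abs_mult mult_left_le_one_le)
  then have "\<bar>v 0 + s * ?b - c 0\<bar> - \<bar>v 0 - c 0\<bar> \<le> ?b" by linarith
  then show ?thesis using assms(2) by (simp add: push_def l1_distance_upd[OF assms(1)])
qed

lemma push_inj:
  assumes "0 < n" "\<bar>s\<bar> < 1" "push n c r s v = push n c r s w"
  shows "v = w"
proof -
  have eq: "v i = w i" if "i \<noteq> 0" for i using fun_cong[OF assms(3), of i] that by (simp add: push_def)
  have "w = v(0 := w 0)" using eq by (auto simp: fun_eq_iff)
  then have dist: "\<bar>l1_distance n v c - l1_distance n w c\<bar> \<le> \<bar>v 0 - w 0\<bar>"
    using l1_distance_upd[OF assms(1), of v "w 0" c] by simp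
  define a where "a = max 0 (r - l1_distance n v c)"
  define b where "b = max 0 (r - l1_distance n w c)"
  have ab: "\<bar>a - b\<bar> \<le> \<bar>v 0 - w 0\<bar>" using dist unfolding a_def b_def by linarith
  have "v 0 + s * a = w 0 + s * b" using fun_cong[OF assms(3), of 0] by (simp add: push_def a_def b_def)
  then have "v 0 - w 0 = - s * (a - b)" by (simp add: algebra_simps)
  then have "\<bar>v 0 - w 0\<bar> = \<bar>s\<bar> * \<bar>a - b\<bar>" by (simp add: abs_mult)
  also have "\<dots> \<le> \<bar>s\<bar> * \<bar>v 0 - w 0\<bar>" using ab by (simp add: mult_left_mono)
  finally have "(1 - \<bar>s\<bar>) * \<bar>v 0 - w 0\<bar> \<le> 0" by (simp add: algebra_simps)
  then have "\<bar>v 0 - w 0\<bar> \<le> 0" using assms(2) by (simp add: mult_le_0_iff)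
  then show ?thesis using eq by (metis abs_le_zero_iff eq_iff_diff_eq_0 ext)
qed

text \<open>
  On the line through \<open>w\<close> in direction of the coordinate \<open>0\<close> the displacement is at most \<open>r\<close>, so the
  intermediate value theorem applies on the interval of radius \<open>r\<close> around \<open>w 0\<close>.
\<close>

lemma push_surj:
  assumes "0 < n" "\<bar>s\<bar> \<le> 1" "w \<in> topspace (Euclidean_space n)" "0 < r"
  shows "\<exists>v\<in>topspace (Euclidean_space n). push n c r s v = w"
proof -
  define \<beta> where "\<beta> t = max 0 (r - l1_distance n (w(0 := t)) c)" for t
  define h where "h t = t + s * \<beta> t" for t
  have \<beta>: "\<beta> t = max 0 (r - (l1_distance n w c + \<bar>t - c 0\<bar> - \<bar>w 0 - c 0\<bar>))" for t
    by (simp add: \<beta>_def l1_distance_upd[OF assms(1)])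
  have cont: "continuous_on S h" for S
    unfolding h_def \<beta> by (intro continuous_intros)
  define R where "R = \<beta> (w 0) + r + 1"
  have "l1_distance n w c \<ge> \<bar>w 0 - c 0\<bar>"
    unfolding l1_distance_def using assms(1) by (intro member_le_sum) auto
  then have "\<beta> t \<le> r" "\<beta> t \<ge> 0" for t using assms(4) by (simp_all add: \<beta>)
  then have "\<bar>s * \<beta> t\<bar> \<le> r" for t
    using assms(2) by (metis abs_mult abs_of_nonneg mult_left_le_one_le abs_ge_zero order_trans)
  then have "h (w 0 - r) \<le> w 0" "w 0 \<le> h (w 0 + r)" unfolding h_def by (smt (verit))+
  then obtain t where "h t = w 0"
    using IVT'[of h "w 0 - r" "w 0" "w 0 + r"] cont assms(4) by auto
  then have "push n c r s (w(0 := t)) = w" by (simp add: push_def h_def \<beta>_def)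
  moreover have "w(0 := t) \<in> topspace (Euclidean_space n)" using assms(1,3) by (simp add: topspace_Euclidean_space)
  ultimately show ?thesis by blast
qed

lemma push_centre: "push n c r s c = c(0 := c 0 + s * max 0 r)"
  by (simp add: push_def l1_distance_def)

lemma continuous_map_push:
  assumes "0 < n" "continuous_map X (Euclidean_space n) g" "continuous_map X euclideanreal s"
  shows "continuous_map X (Euclidean_space n) (\<lambda>x. push n c r (s x) (g x))"
proof -
  have gi: "continuous_map X euclideanreal (\<lambda>x. g x i)" for i
    using assms(2) by (simp add: Euclidean_space_def continuous_map_in_subtopology continuous_map_componentwise_UNIV)
  have g0: "g x i = 0" if "x \<in> topspace X" "\<not> i < n" for x i
    using continuous_map_image_subset_topspace[OF assms(2)] that by (auto simp: topspace_Euclidean_space image_subset_iff)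
  have "continuous_map X (Euclidean_space n) (\<lambda>x i. if i < n then push n c r (s x) (g x) i else 0)"
    unfolding continuous_map_componentwise_Euclidean_space
  proof (intro allI impI)
    fix i
    have bump: "continuous_map X euclideanreal (\<lambda>x. max 0 (r - l1_distance n (g x) c))"
      unfolding l1_distance_def by (intro continuous_intros gi) auto
    have "continuous_map X euclideanreal (\<lambda>x. g x 0 + s x * max 0 (r - l1_distance n (g x) c))"
      by (intro continuous_intros gi assms bump)
    then show "continuous_map X euclideanreal (\<lambda>x. push n c r (s x) (g x) i)"
      using gi[of i] by (cases "i = 0") (simp_all add: push_def)
  qed
  then show ?thesis
    by (rule continuous_map_eq) (use g0 assms(1) in \<open>auto simp: push_def fun_eq_iff\<close>)
qed

section \<open>Orientation preserving homeomorphisms\<close>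

text \<open>
  Let \<open>\<phi>\<close> be the end of an isotopy that is supported in a set \<open>C\<close> contained in an open set \<open>U\<close> on which the
  orientation comes from one class \<open>c\<close>.  Outside \<open>U\<close> the isotopy fixes the point and its complement, so
  the local homology class is preserved by homotopy invariance.  Inside \<open>U\<close> homotopy invariance gives
  \<open>\<phi>\<^sub>* c = c\<close> relative to the complement of \<open>U\<close>, and naturality carries this over to the restrictions of
  \<open>c\<close> to \<open>x\<close> and to \<open>\<phi> x\<close>.
\<close>

lemma supported_isotopy_orientation_preserving:
  fixes F :: "real \<times> 'a \<Rightarrow> 'a"
  defines "\<phi> \<equiv> \<lambda>x. F (1, x)"
  assumes \<mu>: "orientation n M \<mu>"
    and F: "continuous_map (prod_topology (top_of_set {0..1}) M) M F" "\<And>x. F (0, x) = x"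
    and inj: "inj_on \<phi> (topspace M)"
    and fixed: "\<And>t x. \<lbrakk>t \<in> {0..1}; x \<notin> C\<rbrakk> \<Longrightarrow> F (t, x) = x"
    and C: "\<And>t x. \<lbrakk>t \<in> {0..1}; x \<in> C\<rbrakk> \<Longrightarrow> F (t, x) \<in> C" "C \<subseteq> U" "U \<subseteq> topspace M"
    and c: "c \<in> carrier (relative_homology_group (int n) M (topspace M - U))"
      "\<forall>y\<in>U. hom_induced (int n) M (topspace M - U) M (topspace M - {y}) (\<lambda>z. z) c = \<mu> y"
  shows "orientation_preserving n M \<mu> \<phi>"
  unfolding orientation_preserving_def
proof
  fix x assume x: "x \<in> manifold_interior n M"
  then have xM: "x \<in> topspace M" by (simp add: manifold_interior_def)
  have cont: "continuous_map M M \<phi>"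
  proof -
    have "continuous_map M (prod_topology (top_of_set {0..1}) M) (\<lambda>x. (1 :: real, x))"
      by (simp add: continuous_map_pairedI continuous_map_into_subtopology)
    from continuous_map_compose[OF this F(1)] show ?thesis by (simp add: \<phi>_def o_def)
  qed
  have homotopic: "homotopic_with (\<lambda>h. h \<in> S \<rightarrow> S) M M (\<lambda>x. x) \<phi>"
    if "\<And>t. t \<in> {0..1} \<Longrightarrow> (\<lambda>x. F (t, x)) \<in> S \<rightarrow> S" for S
    unfolding homotopic_with_def using F that by (intro exI[of _ F]) (auto simp: \<phi>_def)
  have trivial: "hom_induced (int n) M S M S \<phi> a = a"
    if "\<And>t. t \<in> {0..1} \<Longrightarrow> (\<lambda>x. F (t, x)) \<in> S \<rightarrow> S"
      and "a \<in> carrier (relative_homology_group (int n) M S)" for S a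
    using homology_homotopy_axiom[OF homotopic[OF that(1)], of "int n"]
      hom_induced_id_gen[of M "\<lambda>x. x" a "int n" S] that(2) by simp
  show "hom_induced (int n) M (topspace M - {x}) M (topspace M - {\<phi> x}) \<phi> (\<mu> x) = \<mu> (\<phi> x)"
  proof (cases "x \<in> U")
    case False
    then have x_fixed: "\<phi> x = x" using fixed[of 1 x] C(2) by (auto simp: \<phi>_def)
    have "(\<lambda>y. F (t, y)) \<in> topspace M - {x} \<rightarrow> topspace M - {x}" if t: "t \<in> {0..1}" for t
    proof
      fix y assume "y \<in> topspace M - {x}"
      then show "F (t, y) \<in> topspace M - {x}"
        using fixed[OF t, of y] C(1)[OF t, of y] C(2,3) False by (cases "y \<in> C") auto
    qed
    moreover have "\<mu> x \<in> carrier (relative_homology_group (int n) M (topspace M - {x}))"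
      using \<mu> x by (simp add: orientation_def)
    ultimately show ?thesis using trivial x_fixed by simp
  next
    case True
    have \<phi>U: "\<phi> x \<in> U" using fixed[of 1 x] C(1)[of 1 x] C(2) True by (cases "x \<in> C") (auto simp: \<phi>_def)
    have U_inv: "(\<lambda>y. F (t, y)) \<in> topspace M - U \<rightarrow> topspace M - U" if "t \<in> {0..1}" for t
      using fixed[OF that] C(2) by fastforce
    have \<phi>_U: "\<phi> \<in> topspace M - U \<rightarrow> topspace M - U" using U_inv[of 1] by (simp add: \<phi>_def)
    have \<phi>_x: "\<phi> \<in> topspace M - {x} \<rightarrow> topspace M - {\<phi> x}"
      using inj xM continuous_map_image_subset_topspace[OF cont] by (fastforce simp: inj_on_def)
    have id: "continuous_map M M (\<lambda>z. z)" by simp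
    have "hom_induced (int n) M (topspace M - {x}) M (topspace M - {\<phi> x}) \<phi> (\<mu> x) =
      hom_induced (int n) M (topspace M - {x}) M (topspace M - {\<phi> x}) \<phi>
        (hom_induced (int n) M (topspace M - U) M (topspace M - {x}) (\<lambda>z. z) c)"
      using c(2) True by simp
    also have "\<dots> = hom_induced (int n) M (topspace M - U) M (topspace M - {\<phi> x}) \<phi> c"
      using hom_induced_compose'[OF id _ cont \<phi>_x, of "topspace M - U" "int n" c] True
      by (auto simp: o_def)
    also have "\<dots> = hom_induced (int n) M (topspace M - U) M (topspace M - {\<phi> x}) (\<lambda>z. z)
        (hom_induced (int n) M (topspace M - U) M (topspace M - U) \<phi> c)"
      using hom_induced_compose'[OF cont \<phi>_U id, of "topspace M - {\<phi> x}" "int n" c] \<phi>U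
      by (auto simp: o_def)
    also have "\<dots> = \<mu> (\<phi> x)"
      using trivial[OF U_inv c(1)] c(2) \<phi>U by simp
    finally show ?thesis .
  qed
qed

lemma homeomorphic_map_manifold_interior:
  assumes f: "homeomorphic_map M M f" and x: "x \<in> manifold_interior n M"
  shows "f x \<in> manifold_interior n M"
proof -
  obtain U V where U: "openin M U" "x \<in> U" and V: "openin (Euclidean_space n) V"
    "subtopology M U homeomorphic_space subtopology (Euclidean_space n) V"
    using x by (auto simp: manifold_interior_def)
  have UM: "U \<subseteq> topspace M" using U(1) by (rule openin_subset)
  have "openin M (f ` U)" using homeomorphic_map_openness[OF f UM] U(1) by simp
  moreover have "subtopology M (f ` U) homeomorphic_space subtopology (Euclidean_space n) V"
  proof (rule homeomorphic_space_trans[OF _ V(2)])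
    have "f ` (topspace M \<inter> U) = topspace M \<inter> f ` U"
      using UM openin_subset[OF \<open>openin M (f ` U)\<close>] by (simp add: Int_absorb1)
    from homeomorphic_map_subtopologies[OF f this]
    show "subtopology M (f ` U) homeomorphic_space subtopology M U"
      using homeomorphic_map_imp_homeomorphic_space homeomorphic_space_sym by blast
  qed
  moreover have "f x \<in> f ` U" "f x \<in> topspace M"
    using U(2) openin_subset[OF \<open>openin M (f ` U)\<close>] by auto
  ultimately show ?thesis using V(1) unfolding manifold_interior_def by blast
qed

lemma carrier_Homeo_plus:
  "carrier (Homeo_plus n M \<mu>) =
    {f \<in> extensional (topspace M). homeomorphic_map M M f \<and> orientation_preserving n M \<mu> f}"
  by (simp add: Homeo_plus_def)

lemma orientation_preserving_cong:
  assumes "\<And>x. x \<in> topspace M \<Longrightarrow> f x = g x"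
  shows "orientation_preserving n M \<mu> f \<longleftrightarrow> orientation_preserving n M \<mu> g"
proof -
  have "hom_induced (int n) M S M T f = hom_induced (int n) M S M T g" for S T
    using assms by (rule hom_induced_eq)
  then show ?thesis
    using assms by (auto simp: orientation_preserving_def manifold_interior_def)
qed

lemma homeomorphic_map_punctured:
  assumes "homeomorphic_map M M f" "x \<in> topspace M"
  shows "f \<in> topspace M - {x} \<rightarrow> topspace M - {f x}"
  using homeomorphic_imp_injective_map[OF assms(1)] homeomorphic_imp_surjective_map[OF assms(1)] assms(2)
  by (auto simp: inj_on_def)

lemma orientation_preserving_compose:
  assumes f: "homeomorphic_map M M f" "orientation_preserving n M \<mu> f"
    and g: "homeomorphic_map M M g" "orientation_preserving n M \<mu> g"
  shows "orientation_preserving n M \<mu> (g \<circ> f)"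
  unfolding orientation_preserving_def
proof
  fix x assume x: "x \<in> manifold_interior n M"
  then have M: "x \<in> topspace M" "f x \<in> topspace M" and fx: "f x \<in> manifold_interior n M"
    using homeomorphic_map_manifold_interior[OF f(1)] by (auto simp: manifold_interior_def)
  have "hom_induced (int n) M (topspace M - {x}) M (topspace M - {(g \<circ> f) x}) (g \<circ> f) (\<mu> x) =
    hom_induced (int n) M (topspace M - {f x}) M (topspace M - {g (f x)}) g
      (hom_induced (int n) M (topspace M - {x}) M (topspace M - {f x}) f (\<mu> x))"
    using hom_induced_compose'[OF homeomorphic_imp_continuous_map[OF f(1)] homeomorphic_map_punctured[OF f(1) M(1)]
        homeomorphic_imp_continuous_map[OF g(1)] homeomorphic_map_punctured[OF g(1) M(2)]] by simp
  then show "hom_induced (int n) M (topspace M - {x}) M (topspace M - {(g \<circ> f) x}) (g \<circ> f) (\<mu> x) = \<mu> ((g \<circ> f) x)"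
    using f(2) g(2) x fx by (simp add: orientation_preserving_def)
qed

lemma orientation_preserving_inverse:
  assumes \<mu>: "orientation n M \<mu>" and fg: "homeomorphic_maps M M f g"
    and f: "orientation_preserving n M \<mu> f"
  shows "orientation_preserving n M \<mu> g"
  unfolding orientation_preserving_def
proof
  fix y assume y: "y \<in> manifold_interior n M"
  have maps: "homeomorphic_map M M f" "homeomorphic_map M M g"
    "\<And>x. x \<in> topspace M \<Longrightarrow> g (f x) = x" "\<And>x. x \<in> topspace M \<Longrightarrow> f (g x) = x"
    using fg by (auto simp: homeomorphic_maps_map)
  define x where "x = g y"
  have x: "x \<in> manifold_interior n M" using homeomorphic_map_manifold_interior[OF maps(2) y] by (simp add: x_def)
  have M: "x \<in> topspace M" "y \<in> topspace M" using x y by (auto simp: manifold_interior_def)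
  have fx: "f x = y" using maps(4) M by (simp add: x_def)
  have "hom_induced (int n) M (topspace M - {y}) M (topspace M - {x}) g (\<mu> y) =
    hom_induced (int n) M (topspace M - {y}) M (topspace M - {x}) g
      (hom_induced (int n) M (topspace M - {x}) M (topspace M - {y}) f (\<mu> x))"
    using bspec[OF f[unfolded orientation_preserving_def] x] fx by simp
  also have "\<dots> = hom_induced (int n) M (topspace M - {x}) M (topspace M - {x}) (g \<circ> f) (\<mu> x)"
    using homeomorphic_map_punctured[OF maps(1) M(1)] homeomorphic_map_punctured[OF maps(2) M(2)] fx
    by (intro hom_induced_compose') (simp_all add: x_def homeomorphic_imp_continuous_map maps)
  also have "\<dots> = \<mu> x"
  proof (rule hom_induced_id_gen)
    show "continuous_map M M (g \<circ> f)"
      using maps by (intro continuous_map_compose homeomorphic_imp_continuous_map)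
    show "\<mu> x \<in> carrier (relative_homology_group (int n) M (topspace M - {x}))"
      using \<mu> x by (simp add: orientation_def)
  qed (use maps in simp)
  finally show "hom_induced (int n) M (topspace M - {y}) M (topspace M - {g y}) g (\<mu> y) = \<mu> (g y)"
    by (simp add: x_def)
qed

lemma subgroup_Homeo_plus:
  assumes \<mu>: "orientation n M \<mu>"
  shows "subgroup (carrier (Homeo_plus n M \<mu>)) (BijGroup (topspace M))"
proof (rule group.subgroupI[OF group_BijGroup])
  let ?H = "carrier (Homeo_plus n M \<mu>)" and ?B = "BijGroup (topspace M)"
  have H_Bij: "f \<in> Bij (topspace M)" if "f \<in> ?H" for f
    using that homeomorphic_imp_injective_map[of M M f] homeomorphic_imp_surjective_map[of M M f]
    by (auto simp: carrier_Homeo_plus Bij_def bij_betw_def)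
  then show "?H \<subseteq> carrier ?B" by (auto simp: BijGroup_def)
  have "homeomorphic_map M M (\<lambda>x\<in>topspace M. x)"
    using homeomorphic_map_eq[of M M id "\<lambda>x\<in>topspace M. x"] by simp
  moreover have "orientation_preserving n M \<mu> (\<lambda>x\<in>topspace M. x)"
  proof -
    have "orientation_preserving n M \<mu> (\<lambda>x. x)"
      using \<mu> by (simp add: orientation_preserving_def orientation_def hom_induced_id_gen)
    then show ?thesis by (subst orientation_preserving_cong[of M _ "\<lambda>x. x"]) auto
  qed
  ultimately show "?H \<noteq> {}" by (auto simp: carrier_Homeo_plus)
  fix f assume f: "f \<in> ?H"
  then obtain g where fg: "homeomorphic_maps M M f g"
    by (auto simp: carrier_Homeo_plus homeomorphic_map_maps)
  define h where "h = (\<lambda>x\<in>topspace M. inv_into (topspace M) f x)"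
  have h: "h y = g y" if "y \<in> topspace M" for y
  proof -
    have "g y \<in> topspace M" "f (g y) = y" "inj_on f (topspace M)"
      using fg that homeomorphic_imp_injective_map[of M M f]
      by (auto simp: homeomorphic_maps_def continuous_map_def homeomorphic_map_maps)
    then show ?thesis using that inv_into_f_f[of f "topspace M" "g y"] by (simp add: h_def)
  qed
  have "homeomorphic_map M M h"
    using homeomorphic_map_eq[of M M g h] fg h by (auto simp: homeomorphic_maps_map)
  moreover have "orientation_preserving n M \<mu> h"
    using orientation_preserving_inverse[OF \<mu> fg] f orientation_preserving_cong[of M h g] h
    by (simp add: carrier_Homeo_plus)
  ultimately have "h \<in> ?H" by (simp add: carrier_Homeo_plus h_def)
  then show "inv\<^bsub>?B\<^esub> f \<in> ?H" by (simp add: inv_BijGroup[OF H_Bij[OF f]] h_def)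
  fix k assume k: "k \<in> ?H"
  have eq: "f \<otimes>\<^bsub>?B\<^esub> k = compose (topspace M) f k"
    using H_Bij f k by (simp add: BijGroup_def)
  have "homeomorphic_map M M (f \<circ> k)" "orientation_preserving n M \<mu> (f \<circ> k)"
    using f k by (auto simp: carrier_Homeo_plus intro: homeomorphic_map_compose orientation_preserving_compose)
  moreover have "compose (topspace M) f k x = (f \<circ> k) x" if "x \<in> topspace M" for x
    using that by (simp add: compose_def)
  ultimately show "f \<otimes>\<^bsub>?B\<^esub> k \<in> ?H"
    unfolding eq using homeomorphic_map_eq[of M M "f \<circ> k" "compose (topspace M) f k"]
      orientation_preserving_cong[of M "compose (topspace M) f k" "f \<circ> k"]
    by (simp add: carrier_Homeo_plus)
qed

section \<open>Moving interior points of a manifold\<close>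

text \<open>
  The push of a Euclidean ball is transported to \<open>M\<close> by a chart at \<open>q\<close>.  The chart is first shrunk so that
  it avoids \<open>E\<close> and lies in a set on which the orientation comes from one class.  Different speeds
  \<open>s\<close> send \<open>q\<close> to different places, so some speed moves it off \<open>B\<close>.
\<close>

theorem Homeo_plus_movable:
  fixes M :: "'a topology"
  assumes n: "1 \<le> n" and M: "compact_space M" "Hausdorff_space M" and \<mu>: "orientation n M \<mu>"
    and q: "q \<in> manifold_interior n M" and fin: "finite E" "q \<notin> E" "finite B"
  shows "\<exists>\<phi>\<in>carrier (Homeo_plus n M \<mu>). (\<forall>p\<in>E \<inter> topspace M. \<phi> p = p) \<and> \<phi> q \<notin> B"
proof -
  have n0: "0 < n" using n by simp
  obtain U V where U: "openin M U" "q \<in> U" and V: "openin (Euclidean_space n) V"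
    and UV: "subtopology M U homeomorphic_space subtopology (Euclidean_space n) V"
    using q unfolding manifold_interior_def by blast
  obtain h k where hk: "homeomorphic_maps (subtopology M U) (subtopology (Euclidean_space n) V) h k"
    using UV by (auto simp: homeomorphic_space_def)
  have VE: "V \<subseteq> topspace (Euclidean_space n)" and UM: "U \<subseteq> topspace M"
    using V U by (simp_all add: openin_subset)
  have top: "topspace (subtopology M U) = U" "topspace (subtopology (Euclidean_space n) V) = V"
    using UM VE by auto
  have h: "continuous_map (subtopology M U) (subtopology (Euclidean_space n) V) h"
    and k: "continuous_map (subtopology (Euclidean_space n) V) (subtopology M U) k"
    and kh: "\<And>x. x \<in> U \<Longrightarrow> k (h x) = x" and hkv: "\<And>v. v \<in> V \<Longrightarrow> h (k v) = v"
    using hk unfolding homeomorphic_maps_def top by auto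
  have hU: "h x \<in> V" if "x \<in> U" for x
    using continuous_map_image_subset_topspace[OF h] that unfolding top by auto
  have kV: "k v \<in> U" if "v \<in> V" for v
    using continuous_map_image_subset_topspace[OF k] that unfolding top by auto
  obtain U\<^sub>0 a where U\<^sub>0: "openin M U\<^sub>0" "q \<in> U\<^sub>0"
    and a: "a \<in> carrier (relative_homology_group (int n) M (topspace M - U\<^sub>0))"
      "\<forall>y\<in>U\<^sub>0. hom_induced (int n) M (topspace M - U\<^sub>0) M (topspace M - {y}) (\<lambda>z. z) a = \<mu> y"
    using \<mu> q unfolding orientation_def by blast
  define Q where "Q = U \<inter> U\<^sub>0 \<inter> (topspace M - E \<inter> topspace M)"
  have "closedin M (E \<inter> topspace M)"
    using fin(1) M(2) by (simp add: closedin_Hausdorff_finite)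
  then have Q: "openin M Q" "q \<in> Q" using U U\<^sub>0 fin UM by (auto simp: Q_def)
  have "neighbourhood_base_of (closedin M) M"
    unfolding neighbourhood_base_of_closedin using M by (rule compact_Hausdorff_imp_regular_space)
  \<comment> \<open>The closed set \<open>C\<close> between \<open>W\<close> and \<open>Q\<close> makes the extension by the identity continuous: it is
      the identity on the open complement of \<open>C\<close>, and the chart formula holds on all of \<open>U\<close>.\<close>
  from this[unfolded neighbourhood_base_of, rule_format, OF conjI[OF Q]]
  obtain W C where W: "openin M W" "closedin M C" "q \<in> W" "W \<subseteq> C" "C \<subseteq> Q"
    by (elim exE conjE) (rule that)
  have CU: "C \<subseteq> U" "C \<subseteq> U\<^sub>0" "C \<inter> E = {}" "C \<subseteq> topspace M" using W(5) UM by (auto simp: Q_def)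
  have "openin (Euclidean_space n) (h ` W)"
  proof -
    have "homeomorphic_map (subtopology M U) (subtopology (Euclidean_space n) V) h"
      using hk homeomorphic_map_maps by blast
    moreover have "openin (subtopology M U) W" using W CU U by (auto simp: openin_open_subtopology)
    ultimately have "openin (subtopology (Euclidean_space n) V) (h ` W)"
      using homeomorphic_map_openness openin_subset by blast
    then show ?thesis using V openin_trans_full by blast
  qed
  then obtain r where r: "r > 0"
    and ball: "\<And>v. \<lbrakk>v \<in> topspace (Euclidean_space n); l1_distance n v (h q) \<le> r\<rbrakk> \<Longrightarrow> v \<in> h ` W"
    using Euclidean_ball_in_open[of n "h ` W" "h q"] W(3) by blast
  have hWV: "h ` W \<subseteq> V" using W(4) CU(1) hU by blast
  have outside: "push n (h q) r s (h x) = h x" if "x \<in> U" "x \<notin> W" for s x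
  proof -
    have "h x \<notin> h ` W" using that kh W(4) CU(1) by (metis image_iff subsetD)
    then show ?thesis using ball[of "h x"] hU[OF that(1)] VE by (intro push_outside) force
  qed
  have push_cases: "push n (h q) r s (h x) \<in> h ` W \<or> push n (h q) r s (h x) = h x"
    if "x \<in> U" "\<bar>s\<bar> \<le> 1" for s x
  proof (cases "l1_distance n (h x) (h q) \<le> r")
    case True
    have "h x \<in> topspace (Euclidean_space n)" using hU that VE by blast
    then show ?thesis using ball push_inside[OF n0 True that(2)] push_topspace[OF n0] by blast
  qed (simp add: push_outside)
  have push_V: "push n (h q) r s (h x) \<in> V" if "x \<in> U" "\<bar>s\<bar> \<le> 1" for s x
    using push_cases[OF that] hWV hU[OF that(1)] by auto
  have push_C: "k (push n (h q) r s (h x)) \<in> C" if "x \<in> C" "\<bar>s\<bar> \<le> 1" for s x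
    using push_cases[of x s] that CU(1) W(4) kh by (auto simp: subset_iff)
  obtain s :: real where s: "0 < s" "s < 1" "k (push n (h q) r s (h q)) \<notin> B"
  proof -
    have "inj_on (\<lambda>s. k (push n (h q) r s (h q))) {0<..<1}"
    proof (rule inj_onI)
      fix s t :: real assume st: "s \<in> {0<..<1}" "t \<in> {0<..<1}"
        "k (push n (h q) r s (h q)) = k (push n (h q) r t (h q))"
      then have "push n (h q) r s (h q) = push n (h q) r t (h q)"
        using push_V[OF U(2), of s] push_V[OF U(2), of t] hkv by (metis abs_of_pos greaterThanLessThan_iff less_eq_real_def)
      then have "s * max 0 r = t * max 0 r" unfolding push_centre by (metis add_left_cancel fun_upd_same)
      then show "s = t" using r by simp
    qed
    then have "finite ((\<lambda>s. k (push n (h q) r s (h q))) -` B \<inter> {0<..<1})"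
      using fin(3) by (rule finite_vimage_IntI[rotated])
    moreover have "infinite {0<..<1::real}" by simp
    ultimately have "\<not> {0<..<1} \<subseteq> (\<lambda>s. k (push n (h q) r s (h q))) -` B \<inter> {0<..<1}"
      using finite_subset by blast
    then obtain s :: real where "s \<in> {0<..<1}" "k (push n (h q) r s (h q)) \<notin> B" by blast
    then show thesis using that[of s] by simp
  qed
  define F where "F = (\<lambda>(t, x). if x \<in> C then k (push n (h q) r (t * s) (h x)) else x)"
  have ts: "\<bar>t * s\<bar> \<le> 1" if "t \<in> {0..1}" for t
    using that s by (simp add: abs_mult mult_le_one)
  have F_U: "F (t, x) = k (push n (h q) r (t * s) (h x))" if "x \<in> U" for t x
  proof (cases "x \<in> C")
    case False
    then have "x \<notin> W" using W(4) by blast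
    then show ?thesis using False outside[OF that, of "t * s"] kh[OF that] by (simp add: F_def)
  qed (simp add: F_def)
  have F_fixed: "F (t, x) = x" if "x \<notin> C" for t x using that by (simp add: F_def)
  have F_C: "F (t, x) \<in> C" if "t \<in> {0..1}" "x \<in> C" for t x
    using push_C[OF that(2) ts[OF that(1)]] that by (simp add: F_def)
  let ?P = "prod_topology (top_of_set {0..1::real}) M"
  have F_cont: "continuous_map ?P M F"
  proof (rule pasting_lemma[where I = UNIV and T = "\<lambda>b. {0..1} \<times> (if b then U else topspace M - C)"
        and f = "\<lambda>b. if b then (\<lambda>(t, x). k (push n (h q) r (t * s) (h x))) else snd"])
    fix b :: bool
    show "openin ?P ({0..1} \<times> (if b then U else topspace M - C))"
      using U(1) W(2) by (auto simp: openin_prod_Times_iff openin_diff)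
    show "continuous_map (subtopology ?P ({0..1} \<times> (if b then U else topspace M - C))) M
      (if b then (\<lambda>(t, x). k (push n (h q) r (t * s) (h x))) else snd)"
    proof (cases b)
      case True
      let ?X = "subtopology ?P ({0..1} \<times> U)"
      have topX: "topspace ?X = {0..1} \<times> U" using UM by auto
      have "continuous_map ?X M snd" by (intro continuous_map_from_subtopology continuous_map_snd)
      then have "continuous_map ?X (subtopology M U) snd"
        by (rule continuous_map_into_subtopology) (unfold topX, auto)
      from continuous_map_compose[OF this h]
      have "continuous_map ?X (Euclidean_space n) (h \<circ> snd)"
        using continuous_map_in_subtopology by blast
      moreover have "continuous_map ?X euclideanreal (\<lambda>z. fst z * s)"
      proof -
        have "continuous_map ?P (top_of_set {0..1}) fst" by (rule continuous_map_fst)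
        then have "continuous_map ?X euclideanreal fst"
          using continuous_map_from_subtopology continuous_map_in_subtopology by blast
        then show ?thesis by (intro continuous_intros) auto
      qed
      ultimately have "continuous_map ?X (Euclidean_space n) (\<lambda>z. push n (h q) r (fst z * s) ((h \<circ> snd) z))"
        by (intro continuous_map_push[OF n0])
      then have "continuous_map ?X (subtopology (Euclidean_space n) V) (\<lambda>z. push n (h q) r (fst z * s) ((h \<circ> snd) z))"
      proof (rule continuous_map_into_subtopology)
        show "(\<lambda>z. push n (h q) r (fst z * s) ((h \<circ> snd) z)) \<in> topspace ?X \<rightarrow> V"
          unfolding topX using push_V ts by auto
      qed
      from continuous_map_compose[OF this k]
      have "continuous_map ?X M (k \<circ> (\<lambda>z. push n (h q) r (fst z * s) ((h \<circ> snd) z)))"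
        using continuous_map_in_subtopology by blast
      then show ?thesis using True by (simp add: o_def case_prod_unfold)
    next
      case False
      then show ?thesis by (simp add: continuous_map_from_subtopology continuous_map_snd)
    qed
  next
    fix i j :: bool and z assume z: "z \<in> topspace ?P \<inter> ({0..1} \<times> (if i then U else topspace M - C))
      \<inter> ({0..1} \<times> (if j then U else topspace M - C))"
    obtain t x where tx: "z = (t, x)" by (cases z)
    have "k (push n (h q) r (t * s) (h x)) = x" if "x \<in> U" "x \<notin> C" for t
      using F_U[OF that(1)] F_fixed[OF that(2)] by simp
    then show "(if i then (\<lambda>(t, x). k (push n (h q) r (t * s) (h x))) else snd) z =
      (if j then (\<lambda>(t, x). k (push n (h q) r (t * s) (h x))) else snd) z"
      using z tx by (cases i; cases j) auto
  next
    fix z assume z: "z \<in> topspace ?P"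
    obtain t x where tx: "z = (t, x)" by (cases z)
    show "\<exists>j. j \<in> UNIV \<and> z \<in> {0..1} \<times> (if j then U else topspace M - C) \<and>
      F z = (if j then (\<lambda>(t, x). k (push n (h q) r (t * s) (h x))) else snd) z"
      using z tx F_U F_fixed CU(1) by (intro exI[of _ "x \<in> C"]) auto
  qed
  define \<phi> where "\<phi> = (\<lambda>x. F (1, x))"
  have \<phi>_U: "\<phi> x = k (push n (h q) r s (h x))" if "x \<in> U" for x using F_U[OF that] by (simp add: \<phi>_def)
  have \<phi>_C: "\<phi> x \<in> C \<longleftrightarrow> x \<in> C" for x by (cases "x \<in> C") (simp_all add: \<phi>_def F_C F_fixed)
  have \<phi>_fixed: "\<phi> x = x" if "x \<notin> C" for x using F_fixed[OF that] by (simp add: \<phi>_def)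
  have inj: "inj_on \<phi> (topspace M)"
  proof (rule inj_onI)
    fix x y assume eq: "\<phi> x = \<phi> y"
    then have "x \<in> C \<longleftrightarrow> y \<in> C" using \<phi>_C by metis
    then consider "x \<notin> C" "y \<notin> C" | "x \<in> U" "y \<in> U" using CU(1) by blast
    then show "x = y"
    proof cases
      case 1
      then show ?thesis using eq \<phi>_fixed by simp
    next
      case 2
      have "push n (h q) r s (h x) = push n (h q) r s (h y)"
        using eq 2 push_V[of x s] push_V[of y s] s hkv \<phi>_U by (metis abs_of_pos less_eq_real_def)
      then have "h x = h y" using push_inj[OF n0, of s] s by simp
      then show ?thesis using kh 2 by metis
    qed
  qed
  have cont: "continuous_map M M \<phi>"
  proof -
    have "continuous_map M ?P (\<lambda>x. (1, x))"
      by (simp add: continuous_map_pairedI continuous_map_into_subtopology)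
    from continuous_map_compose[OF this F_cont] show ?thesis by (simp add: \<phi>_def o_def)
  qed
  have surj: "\<phi> ` topspace M = topspace M"
  proof
    show "\<phi> ` topspace M \<subseteq> topspace M" using cont by (rule continuous_map_image_subset_topspace)
    show "topspace M \<subseteq> \<phi> ` topspace M"
    proof
      fix y assume y: "y \<in> topspace M"
      show "y \<in> \<phi> ` topspace M"
      proof (cases "y \<in> C")
        case False
        then show ?thesis using y \<phi>_fixed by (metis imageI)
      next
        case True
        then have yU: "y \<in> U" using CU by blast
        then obtain v where v: "v \<in> topspace (Euclidean_space n)" "push n (h q) r s v = h y"
          using push_surj[OF n0, of s "h y" r "h q"] hU VE s r by force
        show ?thesis
        proof (cases "l1_distance n v (h q) \<le> r")
          case True
          then obtain x where x: "x \<in> W" "v = h x" using ball[OF v(1)] by blast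
          then have "\<phi> x = y" using \<phi>_U[of x] v(2) kh[OF yU] W(4) CU(1) by auto
          then show ?thesis using x W(1) openin_subset by blast
        next
          case False
          then have "v = h y" using v(2) push_outside[of r n v "h q" s] by simp
          then have "\<phi> y = y" using \<phi>_U[OF yU] v(2) kh[OF yU] by simp
          then show ?thesis using y by (metis imageI)
        qed
      qed
    qed
  qed
  have homeo: "homeomorphic_map M M \<phi>"
    using cont M surj inj by (rule continuous_imp_homeomorphic_map)
  have "orientation_preserving n M \<mu> (\<lambda>x. F (1, x))"
  proof (rule supported_isotopy_orientation_preserving[OF \<mu> F_cont _ _ _ _ CU(2) openin_subset[OF U\<^sub>0(1)] a])
    show "F (0, x) = x" for x
    proof (cases "x \<in> U")
      case True
      then show ?thesis using F_U[OF True, of 0] kh[OF True] by (simp add: push_def)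
    next
      case False
      then show ?thesis using F_fixed CU(1) by blast
    qed
  qed (use F_fixed F_C inj \<phi>_def in auto)
  then have orient: "orientation_preserving n M \<mu> \<phi>" by (simp add: \<phi>_def)
  define \<psi> where "\<psi> = restrict \<phi> (topspace M)"
  have eq: "\<psi> x = \<phi> x" if "x \<in> topspace M" for x using that by (simp add: \<psi>_def)
  have "\<psi> \<in> carrier (Homeo_plus n M \<mu>)"
    using homeo orient homeomorphic_map_eq[of M M \<phi> \<psi>] orientation_preserving_cong[of M \<psi> \<phi>] eq
    by (simp add: carrier_Homeo_plus \<psi>_def)
  moreover have "\<psi> p = p" if "p \<in> E \<inter> topspace M" for p
    using that \<phi>_fixed[of p] CU(3) eq by auto
  moreover have "\<psi> q \<notin> B" using s(3) \<phi>_U[OF U(2)] eq U UM by auto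
  ultimately show ?thesis by blast
qed

text \<open>
  A chart at any point meets the open half-space: increasing the coordinate \<open>0\<close> a little leads from a
  boundary point of the half-space to a point at which the chart is Euclidean.
\<close>

lemma manifold_interior_nonempty:
  assumes n: "1 \<le> n" and M: "topological_manifold n M" "topspace M \<noteq> {}"
  shows "manifold_interior n M \<noteq> {}"
proof -
  let ?E = "Euclidean_space n"
  obtain x U V where U: "openin M U" "x \<in> U" and V: "openin (half_space n) V"
    and UV: "subtopology M U homeomorphic_space subtopology (half_space n) V"
    using M unfolding topological_manifold_def by blast
  obtain h k where hk: "homeomorphic_maps (subtopology M U) (subtopology (half_space n) V) h k"
    using UV by (auto simp: homeomorphic_space_def)
  obtain T where T: "openin ?E T" "V = T \<inter> {x. 0 \<le> x 0}"
    using V by (auto simp: half_space_def openin_subtopology)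
  have TE: "T \<subseteq> topspace ?E" using T(1) by (rule openin_subset)
  have VH: "V \<subseteq> topspace (half_space n)" and UM: "U \<subseteq> topspace M"
    using U V by (simp_all add: openin_subset)
  have top: "topspace (subtopology M U) = U" "topspace (subtopology (half_space n) V) = V"
    using UM VH by auto
  have kV: "k ` V = U"
  proof -
    have "homeomorphic_map (subtopology (half_space n) V) (subtopology M U) k"
      using hk by (simp add: homeomorphic_maps_map)
    from homeomorphic_imp_surjective_map[OF this] show ?thesis by (simp only: top)
  qed
  have "h x \<in> V"
    using hk U(2) unfolding homeomorphic_maps_def continuous_map_def top by auto
  then have hx: "h x \<in> T" "0 \<le> h x 0" using T(2) by auto
  obtain r where r: "r > 0" and ball: "\<And>v. \<lbrakk>v \<in> topspace ?E; l1_distance n v (h x) \<le> r\<rbrakk> \<Longrightarrow> v \<in> T"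
    using Euclidean_ball_in_open[OF T(1) hx(1)] by blast
  define v where "v = (h x)(0 := h x 0 + r)"
  have "v \<in> topspace ?E" using hx(1) TE n by (auto simp: v_def topspace_Euclidean_space)
  moreover have "l1_distance n v (h x) \<le> r"
    using l1_distance_upd[of n "h x" "h x 0 + r" "h x"] n r by (simp add: v_def l1_distance_def)
  ultimately have v: "v \<in> T" by (rule ball)
  define V' where "V' = T \<inter> {x. 0 < x 0}"
  have v': "v \<in> V'" using v hx r by (simp add: V'_def v_def)
  have V'E: "openin ?E V'"
  proof -
    have "continuous_map ?E euclideanreal (\<lambda>x. x 0)"
      unfolding Euclidean_space_def
      by (rule continuous_map_from_subtopology) (auto intro: continuous_map_product_projection)
    then have "openin ?E {x \<in> topspace ?E. x 0 \<in> {0<..}}"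
      by (rule openin_continuous_map_preimage) simp
    then have "openin ?E (T \<inter> {x \<in> topspace ?E. x 0 \<in> {0<..}})" using T(1) by blast
    moreover have "T \<inter> {x \<in> topspace ?E. x 0 \<in> {0<..}} = V'" using TE by (auto simp: V'_def)
    ultimately show ?thesis by simp
  qed
  have V'V: "V' \<subseteq> V" by (auto simp: V'_def T(2))
  have V'_half: "openin (half_space n) V'"
    unfolding half_space_def openin_subtopology using V'E by (intro exI[of _ V']) (auto simp: V'_def)
  have k_homeo: "homeomorphic_map (subtopology (half_space n) V) (subtopology M U) k"
    using hk by (simp add: homeomorphic_maps_map)
  define U' where "U' = k ` V'"
  have U'U: "U' \<subseteq> U" using V'V kV by (auto simp: U'_def)
  have "openin (subtopology (half_space n) V) V'" using V'_half V'V by (auto simp: openin_subtopology)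
  then have "openin (subtopology M U) U'"
    using homeomorphic_map_openness[OF k_homeo, of V'] V'V VH top unfolding U'_def by auto
  then have U'_open: "openin M U'" using U(1) openin_trans_full by blast
  have "k ` (topspace (subtopology (half_space n) V) \<inter> V') = topspace (subtopology M U) \<inter> U'"
    using V'V U'U unfolding top by (auto simp: U'_def)
  from homeomorphic_map_subtopologies[OF k_homeo this]
  have "homeomorphic_map (subtopology (half_space n) V') (subtopology M U') k"
    using V'V U'U by (simp add: subtopology_subtopology Int_absorb1)
  moreover have "subtopology (half_space n) V' = subtopology ?E V'"
    unfolding half_space_def subtopology_subtopology
    by (rule arg_cong[of _ _ "subtopology ?E"]) (auto simp: V'_def)
  ultimately have "subtopology M U' homeomorphic_space subtopology ?E V'"
    using homeomorphic_map_imp_homeomorphic_space homeomorphic_space_sym by metis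
  then have "k v \<in> manifold_interior n M"
    using U'_open V'E v' openin_subset[OF U'_open] unfolding manifold_interior_def U'_def by blast
  then show ?thesis by blast
qed

section \<open>Girth of dense groups of homeomorphisms\<close>

text \<open>
  The supremum is attained at the empty generating set, over which no non-empty word exists.
\<close>

lemma girth_trivial_group:
  assumes "group G" "carrier G = {\<one>\<^bsub>G\<^esub>}"
  shows "girth G = \<infinity>"
proof -
  have "finite_generating_set G {}"
    using group.generate_empty[OF assms(1)] assms(2) by (simp add: finite_generating_set_def)
  moreover have "girth_wrt G {} = \<infinity>"
  proof -
    have "relations G {} = {}" by (auto simp: relations_def)
    then show ?thesis by (simp add: girth_wrt_def top_enat_def)
  qed
  ultimately have "\<infinity> \<le> girth G"
    unfolding girth_def by (intro SUP_upper2[of "{}"]) auto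
  then show ?thesis by simp
qed

lemma Homeo_plus_bi_uniform:
  assumes "mtopology_of d = M" "compact_space M" "orientation n M \<mu>"
  shows "carrier (Homeo_plus n M \<mu>) \<subseteq> bi_uniform d"
proof
  fix f assume f: "f \<in> carrier (Homeo_plus n M \<mu>)"
  have top: "topspace M = mspace d" using assms(1) by auto
  have uniform: "uniformly_continuous_map d d g" if "g \<in> carrier (Homeo_plus n M \<mu>)" for g
    using that assms by (auto simp: carrier_Homeo_plus intro!: continuous_imp_uniformly_continuous_map
        homeomorphic_imp_continuous_map)
  have "f \<in> Bij (mspace d)" "m_inv (BijGroup (mspace d)) f \<in> carrier (Homeo_plus n M \<mu>)"
    using f subgroup.subset[OF subgroup_Homeo_plus[OF assms(3)]]
      subgroup.m_inv_closed[OF subgroup_Homeo_plus[OF assms(3)] f] by (auto simp: top BijGroup_def)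
  then show "f \<in> bi_uniform d" using uniform f by (simp add: bi_uniform_def)
qed

lemma C0_dense_approximation:
  assumes d: "mtopology_of d = M" and M: "compact_space M"
    and dense: "C0_topology n M \<mu> d closure_of \<Gamma> = carrier (Homeo_plus n M \<mu>)"
    and f: "f \<in> carrier (Homeo_plus n M \<mu>)" and \<epsilon>: "\<epsilon> > 0"
  shows "\<exists>\<gamma>\<in>\<Gamma>. \<forall>p\<in>topspace M. mdist d (\<gamma> p) (f p) < \<epsilon>"
proof -
  interpret C: Metric_space "mspace (cfunspace M d)" "mdist (cfunspace M d)"
    by (rule Metric_space_mspace_mdist)
  have "f \<in> mtopology_of (cfunspace M d) closure_of (carrier (Homeo_plus n M \<mu>) \<inter> \<Gamma>)"
    using f dense unfolding C0_topology_def closure_of_subtopology by blast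
  then have "f \<in> C.mtopology closure_of (carrier (Homeo_plus n M \<mu>) \<inter> \<Gamma>)"
    by (simp only: mtopology_of_def)
  then obtain \<gamma> where \<gamma>: "\<gamma> \<in> \<Gamma>" "\<gamma> \<in> C.mball f \<epsilon>"
    using \<epsilon> unfolding C.metric_closure_of by blast
  then have "\<gamma> \<in> mspace (cfunspace M d)" "f \<in> mspace (cfunspace M d)" "mdist (cfunspace M d) \<gamma> f < \<epsilon>"
    by (auto simp only: C.in_mball C.commute)
  then have "mdist d (\<gamma> p) (f p) < \<epsilon>" if "p \<in> topspace M" for p
    using cfunspace_mdist_lt[of M \<gamma> d f \<epsilon> p] M that unfolding compact_space_def by blast
  then show ?thesis using \<gamma>(1) by blast
qed

theorem theorem1p2:
  fixes M :: "'a topology" and d :: "'a metric" and n :: nat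
    and \<mu> :: "'a \<Rightarrow> 'a chain set" and \<Gamma> :: "('a \<Rightarrow> 'a) set"
  assumes "n \<ge> 1"
    and "topological_manifold n M"
    and "compact_space M"
    and "orientation n M \<mu>"
    and "mtopology_of d = M"
    and "subgroup \<Gamma> (Homeo_plus n M \<mu>)"
    and "\<exists>S. finite_generating_set (Homeo_plus n M \<mu> \<lparr>carrier := \<Gamma>\<rparr>) S"
    and "C0_topology n M \<mu> d closure_of \<Gamma> = carrier (Homeo_plus n M \<mu>)"
  shows "girth (Homeo_plus n M \<mu> \<lparr>carrier := \<Gamma>\<rparr>) = \<infinity>"
proof -
  let ?H = "carrier (Homeo_plus n M \<mu>)" and ?B = "BijGroup (topspace M)"
  have top: "topspace M = mspace d" using assms(5) by auto
  have eq: "Homeo_plus n M \<mu> \<lparr>carrier := \<Gamma>\<rparr> = ?B\<lparr>carrier := \<Gamma>\<rparr>"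
    by (simp add: Homeo_plus_def)
  have H: "subgroup ?H ?B" using assms(4) by (rule subgroup_Homeo_plus)
  have \<Gamma>H: "\<Gamma> \<subseteq> ?H" using assms(6) by (rule subgroup.subset)
  have "subgroup \<Gamma> (?B\<lparr>carrier := ?H\<rparr>)" using assms(6) by (simp add: Homeo_plus_def)
  with H have \<Gamma>: "subgroup \<Gamma> ?B" by (rule group.incl_subgroup[OF group_BijGroup])
  obtain S where S: "finite_generating_set (?B\<lparr>carrier := \<Gamma>\<rparr>) S" using assms(7) eq by auto
  show ?thesis
  proof (cases "topspace M = {}")
    case True
    \<comment> \<open>The empty space has only one extensional self-map, so the group is trivial.\<close>
    have "f = g" if "f \<in> \<Gamma>" "g \<in> \<Gamma>" for f g
    proof -
      have "f \<in> extensional (topspace M)" "g \<in> extensional (topspace M)"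
        using that \<Gamma>H by (auto simp: carrier_Homeo_plus)
      then show ?thesis by (rule extensionalityI) (simp add: True)
    qed
    then have "carrier (?B\<lparr>carrier := \<Gamma>\<rparr>) = {\<one>\<^bsub>?B\<lparr>carrier := \<Gamma>\<rparr>\<^esub>}"
      using subgroup.one_closed[OF \<Gamma>] by auto
    with subgroup.subgroup_is_group[OF \<Gamma> group_BijGroup] show ?thesis
      unfolding eq by (rule girth_trivial_group)
  next
    case False
    have Hausdorff: "Hausdorff_space M" using assms(2) by (simp add: topological_manifold_def)
    interpret movable_action "topspace M" ?H "manifold_interior n M"
    proof (rule movable_action.intro)
      show "subgroup ?H ?B" by (rule H)
      show "manifold_interior n M \<subseteq> topspace M" by (auto simp: manifold_interior_def)
      show "manifold_interior n M \<noteq> {}" using assms(1,2) False by (rule manifold_interior_nonempty)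
      show "f q \<in> manifold_interior n M" if "f \<in> ?H" "q \<in> manifold_interior n M" for f q
        using that homeomorphic_map_manifold_interior by (auto simp: carrier_Homeo_plus)
      show "\<exists>\<phi>\<in>?H. (\<forall>p\<in>F \<inter> topspace M. \<phi> p = p) \<and> \<phi> q \<notin> B"
        if "q \<in> manifold_interior n M" "finite F" "q \<notin> F" "finite B" for q F B
        using assms(1,3) Hausdorff assms(4) that by (rule Homeo_plus_movable)
    qed
    show ?thesis
      unfolding eq
      using top \<Gamma> \<Gamma>H Homeo_plus_bi_uniform[OF assms(5,3,4)] C0_dense_approximation[OF assms(5,3,8)] S
      by (rule girth_dense_subgroup)
  qed
qed

end
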